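(* Let $A\in M_n$, $B\in M_m$, $c\in\mathbb{R}^n$, $d\in\mathbb{R}^m$ with $W(A;c)$ and $W(B;d)$ nonempty. Suppose $W(A;c)$ and $W(B;d)$ have more than $\deg(A;c)\deg(B;d)$ pairwise distinct common supporting lines, and that: (1) either $W(A;c)=W_c(A)$, or $W(A;c)$ has nonempty interior and each of these common supporting lines touches $\partial W(A;c)$ at a point where $\partial W(A;c)$ is differentiable; (2) either $W(B;d)=W_d(B)$, or $W(B;d)$ has nonempty interior and each of these common supporting lines touches $\partial W(B;d)$ at a point where $\partial W(B;d)$ is differentiable. Then there exists a $c$-value of $A$ which is also a $d$-value of $B$. Furthermore, if $r(A;c)$ is irreducible in $\mathbb{C}[x,y,t]$, then every $c$-value of $A$ is a $d$-value of $B$.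
   Context: $M_n$ denotes the space of $n\times n$ complex matrices. For $A\in M_n$ and $\theta\in\mathbb{R}$, $H_\theta(A)=\frac{1}{2}(e^{i\theta}A+e^{-i\theta}A^* )$; for a Hermitian $H$, $\lambda_1(H)\ge\cdots\ge\lambda_n(H)$ are its eigenvalues in nonincreasing order with multiplicity. For $c\in\mathbb{R}^n$ the weighted numerical range is $W(A;c)=\bigcap_{\theta\in[0,2\pi)}\{v\in\mathbb{C}:\mathrm{Re}(e^{i\theta}v)\le\sum_{j=1}^n c_j\lambda_j(H_\theta(A))\}$, and the $c$-numerical range is $W_c(A)=\{\sum_{j=1}^n c_jx_j^*Ax_j:\ x_1,\dots,x_n\in\mathbb{C}^n\text{ orthonormal}\}$. A common supporting line of two nonempty sets $K_1,K_2\subseteq\mathbb{C}$ is a line $L$ meeting both sets such that $K_1$ and $K_2$ lie in the same closed half-plane bounded by $L$. For a general $M\in M_n$ let $\lambda_1(M),\dots,\lambda_n(M)$ be its eigenvalues with algebraic multiplicity. Let $i_1<\dots<i_r$ be the indices with $c_{i_s}\ne0$. A $c$-value of $M$ is $\sum_{s=1}^r c_{i_s}\lambda_{j_s}(M)$ with $j_1,\dots,j_r$ pairwise distinct. Call index tuples formally equivalent if the linear forms $\sum_s c_{i_s}X_{j_s}$, $\sum_s c_{i_s}X_{j'_s}$ in indeterminates coincide; with $\mathcal{F}$ a set of class representatives, $p(M;c)(t)=\prod_{(j_s)\in\mathcal{F}}(t-\sum_s c_{i_s}\lambda_{j_s}(M))$ and $\deg(M;c)=|\mathcal{F}|$. Set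 $r(A;c)(x,y,t)=p(xA+yA^*;c)(t)$, a homogeneous polynomial of degree $\deg(A;c)$. Analogous definitions for $B\in M_m$, $d\in\mathbb{R}^m$. *)

theory Defs
  imports "HOL-Analysis.Analysis"
    "HOL-Computational_Algebra.Fundamental_Theorem_Algebra"
    "Jordan_Normal_Form.Schur_Decomposition"
    "Jordan_Normal_Form.Char_Poly"
begin

text \<open>Matrices are Jordan_Normal_Form matrices of type complex mat; an n x n matrix is
  one in carrier_mat n n. Weight vectors c in R^n are functions c :: nat => real, only the
  values c 0, ..., c (n-1) being relevant (0-based indexing of c_1, ..., c_n).\<close>

definition H_theta :: "real \<Rightarrow> complex mat \<Rightarrow> complex mat" where
  "H_theta \<theta> A = (1/2 :: complex) \<cdot>\<^sub>m (exp (\<i> * of_real \<theta>) \<cdot>\<^sub>m A + exp (- \<i> * of_real \<theta>) \<cdot>\<^sub>m mat_adjoint A)"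

definition eig_mset :: "complex mat \<Rightarrow> complex multiset" where
  "eig_mset M = proots (char_poly M)"

text \<open>Eigenvalues of a Hermitian matrix in nonincreasing order: herm_eig H ! j is
  lambda_{j+1}(H).\<close>
definition herm_eig :: "complex mat \<Rightarrow> real list" where
  "herm_eig H = rev (sorted_list_of_multiset (image_mset Re (eig_mset H)))"

definition W_weighted :: "nat \<Rightarrow> complex mat \<Rightarrow> (nat \<Rightarrow> real) \<Rightarrow> complex set" where
  "W_weighted n A c = (\<Inter>\<theta>\<in>{0..<2*pi}.
     {v. Re (exp (\<i> * of_real \<theta>) * v) \<le> (\<Sum>j<n. c j * herm_eig (H_theta \<theta> A) ! j)})"

definition W_c :: "nat \<Rightarrow> complex mat \<Rightarrow> (nat \<Rightarrow> real) \<Rightarrow> complex set" where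
  "W_c n A c = {(\<Sum>j<n. of_real (c j) * (conjugate (x j) \<bullet> (A *\<^sub>v x j))) | x.
     (\<forall>j<n. x j \<in> carrier_vec n) \<and>
     (\<forall>j<n. \<forall>k<n. conjugate (x j) \<bullet> x k = (if j = k then 1 else 0))}"

definition is_line :: "complex set \<Rightarrow> bool" where
  "is_line L \<longleftrightarrow> (\<exists>u a. u \<noteq> 0 \<and> L = {z. Re (cnj u * z) = a})"

definition common_supporting_line :: "complex set \<Rightarrow> complex set \<Rightarrow> complex set \<Rightarrow> bool" where
  "common_supporting_line K1 K2 L \<longleftrightarrow>
     L \<inter> K1 \<noteq> {} \<and> L \<inter> K2 \<noteq> {} \<and>
     (\<exists>u a. u \<noteq> 0 \<and> L = {z. Re (cnj u * z) = a} \<and>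
        K1 \<subseteq> {z. Re (cnj u * z) \<le> a} \<and> K2 \<subseteq> {z. Re (cnj u * z) \<le> a})"

definition boundary_differentiable_at :: "complex set \<Rightarrow> complex \<Rightarrow> bool" where
  "boundary_differentiable_at S z \<longleftrightarrow> z \<in> frontier S \<and>
     (\<exists>u f e. cmod u = 1 \<and> e > 0 \<and> f 0 = (0::real) \<and> f differentiable (at 0) \<and>
        frontier S \<inter> ball z e = range (\<lambda>s. z + u * Complex s (f s)) \<inter> ball z e)"

definition eig_list :: "complex mat \<Rightarrow> complex list" where
  "eig_list M = (SOME xs. mset xs = eig_mset M)"

text \<open>Index tuples: an injective assignment sigma of eigenvalue indices j_s = sigma i_s
  to the indices i with c_i \<noteq> 0. Its linear form sum_s c_{i_s} X_{j_s} is represented by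
  its coefficient function k \<mapsto> coefficient of X_k.\<close>
definition supp_c :: "nat \<Rightarrow> (nat \<Rightarrow> real) \<Rightarrow> nat set" where
  "supp_c n c = {i. i < n \<and> c i \<noteq> 0}"

definition index_tuple :: "nat \<Rightarrow> (nat \<Rightarrow> real) \<Rightarrow> (nat \<Rightarrow> nat) \<Rightarrow> bool" where
  "index_tuple n c \<sigma> \<longleftrightarrow> inj_on \<sigma> (supp_c n c) \<and> \<sigma> ` supp_c n c \<subseteq> {..<n}"

definition lin_form :: "nat \<Rightarrow> (nat \<Rightarrow> real) \<Rightarrow> (nat \<Rightarrow> nat) \<Rightarrow> nat \<Rightarrow> real" where
  "lin_form n c \<sigma> k = (\<Sum>i\<in>{i\<in>supp_c n c. \<sigma> i = k}. c i)"

text \<open>The set of linear forms = the set of formal equivalence classes of index tuples.\<close>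
definition forms :: "nat \<Rightarrow> (nat \<Rightarrow> real) \<Rightarrow> (nat \<Rightarrow> real) set" where
  "forms n c = {lin_form n c \<sigma> | \<sigma>. index_tuple n c \<sigma>}"

definition c_value :: "nat \<Rightarrow> complex mat \<Rightarrow> (nat \<Rightarrow> real) \<Rightarrow> complex \<Rightarrow> bool" where
  "c_value n M c v \<longleftrightarrow> (\<exists>\<sigma>. index_tuple n c \<sigma> \<and>
     v = (\<Sum>s\<in>supp_c n c. of_real (c s) * eig_list M ! \<sigma> s))"

definition p_poly :: "nat \<Rightarrow> complex mat \<Rightarrow> (nat \<Rightarrow> real) \<Rightarrow> complex poly" where
  "p_poly n M c = (\<Prod>f\<in>forms n c. [:- (\<Sum>k<n. of_real (f k) * eig_list M ! k), 1:])"

definition deg_c :: "nat \<Rightarrow> (nat \<Rightarrow> real) \<Rightarrow> nat" where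
  "deg_c n c = card (forms n c)"

text \<open>C[x,y,t] is represented as ((C[x])[y])[t] = complex poly poly poly.\<close>
definition eval3 :: "complex poly poly poly \<Rightarrow> complex \<Rightarrow> complex \<Rightarrow> complex \<Rightarrow> complex" where
  "eval3 q x y t = poly (poly (poly q [:[:t:]:]) [:y:]) x"

definition r_poly :: "nat \<Rightarrow> complex mat \<Rightarrow> (nat \<Rightarrow> real) \<Rightarrow> complex poly poly poly" where
  "r_poly n A c = (THE q. \<forall>x y t. eval3 q x y t =
      poly (p_poly n (x \<cdot>\<^sub>m A + y \<cdot>\<^sub>m mat_adjoint A) c) t)"

end

theory Submission
  imports Defs "Subresultants.Subresultant_Gcd" "Jordan_Normal_Form.Jordan_Normal_Form_Existence"
    "HOL-Computational_Algebra.Field_as_Ring"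
begin

unbundle no m_inv_syntax and no inner_syntax

text \<open>A supporting line \<open>Re (e\<^sup>i\<^sup>\<theta> z) = a\<close> of \<open>W(A; c)\<close> gives a zero
  \<open>(e\<^sup>i\<^sup>\<theta> : e\<^sup>-\<^sup>i\<^sup>\<theta> : 2a)\<close> of the homogeneous polynomial \<open>r(A; c)\<close>. If the weighted range is
  the \<open>c\<close>-numerical range, this is because eigenvectors of \<open>H\<^sub>\<theta>\<close> attain the bound defining the
  range; otherwise a limit of nearly supporting directions gives some supporting line with this
  property at the point of contact, and differentiability makes the supporting line there unique.
  Distinct common supporting lines give distinct common zeros of \<open>r(A; c)\<close> and \<open>r(B; d)\<close>, all with
  \<open>y \<noteq> 0\<close>, so by Bezout's theorem the resultant of the two polynomials with respect to \<open>t\<close> vanishes.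
  At \<open>(x, y) = (1, 0)\<close> this says that there is a common value, and if \<open>r(A; c)\<close> is irreducible, it
  must divide \<open>r(B; d)\<close>.\<close>

section \<open>Symmetric functions with values in an algebra of functions\<close>

lemma degree_prod_linear:
  fixes \<mu> :: "'i \<Rightarrow> 'a :: idom"
  shows "degree (\<Prod>i\<in>I. [:- \<mu> i, 1:]) = card I"
  by (cases "finite I") (simp_all add: degree_prod_sum_eq)

lemma coeff_prod_linear_reversed:
  fixes \<mu> :: "'i \<Rightarrow> 'a :: idom"
  shows "coeff (\<Prod>i\<in>I. [:1, - \<mu> i:]) k =
    (if k \<le> card I then coeff (\<Prod>i\<in>I. [:- \<mu> i, 1:]) (card I - k) else 0)"
proof -
  have "reflect_poly [:- \<mu> i, 1:] = [:1, - \<mu> i:]" for i by (simp add: reflect_poly_def cCons_def)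
  hence "(\<Prod>i\<in>I. [:1, - \<mu> i:]) = reflect_poly (\<Prod>i\<in>I. [:- \<mu> i, 1:])"
    unfolding reflect_poly_prod by (rule prod.cong[OF refl, symmetric])
  thus ?thesis by (simp only: coeff_reflect_poly degree_prod_linear not_less[symmetric]) simp
qed

lemma coeff_cofactor_linear:
  fixes q :: "'a :: comm_ring_1 poly"
  shows "coeff q k = (\<Sum>l\<le>k. coeff ([:1, - a:] * q) l * a ^ (k - l))"
proof (induction k)
  case (Suc k)
  have "coeff q (Suc k) = coeff ([:1, - a:] * q) (Suc k) + coeff q k * a" by simp
  also have "coeff q k * a = (\<Sum>l\<le>k. coeff ([:1, - a:] * q) l * a ^ (Suc k - l))"
    by (subst Suc.IH) (simp add: sum_distrib_right Suc_diff_le mult.assoc mult.commute[of a])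
  finally show ?case by simp
qed simp

text \<open>The polynomial with linear factors \<open>1 - \<mu> X\<close> covers \<open>k < card I\<close> and \<open>k \<ge> card I\<close> at once.\<close>
lemma newton_identity:
  fixes \<mu> :: "'i \<Rightarrow> 'a :: idom"
  assumes "finite I"
  defines "p \<equiv> \<Prod>i\<in>I. [:1, - \<mu> i:]"
  shows "of_nat (Suc k) * coeff p (Suc k) = - (\<Sum>l\<le>k. coeff p l * (\<Sum>i\<in>I. \<mu> i ^ (Suc k - l)))"
proof -
  define q where "q i = (\<Prod>j\<in>I - {i}. [:1, - \<mu> j:])" for i
  have p: "p = [:1, - \<mu> i:] * q i" if "i \<in> I" for i
    unfolding p_def q_def using assms(1) that by (simp add: prod.remove)
  have "pderiv p = (\<Sum>i\<in>I. q i * pderiv [:1, - \<mu> i:])"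
    unfolding p_def q_def by (rule pderiv_prod)
  hence "of_nat (Suc k) * coeff p (Suc k) = coeff (\<Sum>i\<in>I. q i * pderiv [:1, - \<mu> i:]) k"
    by (simp only: coeff_pderiv[symmetric])
  also have "\<dots> = - (\<Sum>i\<in>I. coeff (q i) k * \<mu> i)"
    by (simp add: coeff_sum pderiv_pCons sum_negf mult.commute)
  also have "(\<Sum>i\<in>I. coeff (q i) k * \<mu> i) = (\<Sum>i\<in>I. \<Sum>l\<le>k. coeff p l * \<mu> i ^ (Suc k - l))"
  proof (rule sum.cong[OF refl])
    fix i assume "i \<in> I"
    have "coeff (q i) k = (\<Sum>l\<le>k. coeff p l * \<mu> i ^ (k - l))"
      unfolding p[OF \<open>i \<in> I\<close>] by (rule coeff_cofactor_linear)
    thus "coeff (q i) k * \<mu> i = (\<Sum>l\<le>k. coeff p l * \<mu> i ^ (Suc k - l))"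
      by (simp add: sum_distrib_right Suc_diff_le mult.assoc mult.commute[of "\<mu> i"])
  qed
  also have "\<dots> = (\<Sum>l\<le>k. coeff p l * (\<Sum>i\<in>I. \<mu> i ^ (Suc k - l)))"
    by (subst sum.swap) (simp add: sum_distrib_left)
  finally show ?thesis .
qed

text \<open>The index \<open>i\<close> of the power sum is either one of the \<open>\<pi> k\<close> already present or a fresh one, and
  all fresh indices contribute equally.\<close>
lemma sum_permutations_monomial_mult_power_sum:
  fixes \<alpha> :: "'i \<Rightarrow> 'a :: comm_semiring_1"
  assumes I: "finite I" "insert a S \<subseteq> I" and a: "a \<notin> S"
  shows "(\<Sum>\<pi> | \<pi> permutes I. \<Prod>k\<in>S. \<alpha> (\<pi> k) ^ e k) * (\<Sum>i\<in>I. \<alpha> i ^ e a) =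
    (\<Sum>b\<in>S. \<Sum>\<pi> | \<pi> permutes I. \<Prod>k\<in>S. \<alpha> (\<pi> k) ^ (e(b := e b + e a)) k) +
    of_nat (card (I - S)) * (\<Sum>\<pi> | \<pi> permutes I. \<Prod>k\<in>insert a S. \<alpha> (\<pi> k) ^ e k)"
proof -
  define F where "F \<pi> b = (\<Prod>k\<in>S. \<alpha> (\<pi> k) ^ e k) * \<alpha> (\<pi> b) ^ e a" for \<pi> b
  have S: "finite S" "S \<subseteq> I" using I finite_subset by auto
  have "(\<Sum>i\<in>I. \<alpha> i ^ e a) = (\<Sum>b\<in>I. \<alpha> (\<pi> b) ^ e a)" if "\<pi> permutes I" for \<pi>
    using sum.permute[OF that, of "\<lambda>i. \<alpha> i ^ e a"] by (simp add: comp_def)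
  hence "(\<Sum>\<pi> | \<pi> permutes I. \<Prod>k\<in>S. \<alpha> (\<pi> k) ^ e k) * (\<Sum>i\<in>I. \<alpha> i ^ e a) =
      (\<Sum>\<pi> | \<pi> permutes I. \<Sum>b\<in>I. F \<pi> b)"
    unfolding sum_distrib_right F_def sum_distrib_left[symmetric] by (intro sum.cong refl) auto
  also have "\<dots> = (\<Sum>b\<in>I. \<Sum>\<pi> | \<pi> permutes I. F \<pi> b)"
    by (rule sum.swap)
  also have "\<dots> = (\<Sum>b\<in>S. \<Sum>\<pi> | \<pi> permutes I. F \<pi> b) + (\<Sum>b\<in>I - S. \<Sum>\<pi> | \<pi> permutes I. F \<pi> b)"
    using I(1) S by (simp add: sum.subset_diff add.commute)
  also have "(\<Sum>b\<in>S. \<Sum>\<pi> | \<pi> permutes I. F \<pi> b) =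
      (\<Sum>b\<in>S. \<Sum>\<pi> | \<pi> permutes I. \<Prod>k\<in>S. \<alpha> (\<pi> k) ^ (e(b := e b + e a)) k)"
    unfolding F_def using S(1)
    by (intro sum.cong refl) (auto simp: prod.remove power_add mult_ac intro!: prod.cong)
  also have "(\<Sum>b\<in>I - S. \<Sum>\<pi> | \<pi> permutes I. F \<pi> b) = (\<Sum>b\<in>I - S. \<Sum>\<pi> | \<pi> permutes I. F \<pi> a)"
  proof (rule sum.cong[OF refl])
    fix b assume b: "b \<in> I - S"
    let ?\<tau> = "Transposition.transpose a b"
    have "?\<tau> permutes I" using b I by (intro permutes_swap_id) auto
    hence "(\<Sum>\<pi> | \<pi> permutes I. F \<pi> b) = (\<Sum>\<pi> | \<pi> permutes I. F (\<pi> \<circ> ?\<tau>) b)"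
      by (rule sum_permutations_compose_right)
    moreover have "F (\<pi> \<circ> ?\<tau>) b = F \<pi> a" for \<pi>
      unfolding F_def using a b
      by (auto simp: Transposition.transpose_def intro!: arg_cong2[of _ _ _ _ "(*)"] prod.cong)
    ultimately show "(\<Sum>\<pi> | \<pi> permutes I. F \<pi> b) = (\<Sum>\<pi> | \<pi> permutes I. F \<pi> a)" by simp
  qed
  also have "\<dots> = of_nat (card (I - S)) * (\<Sum>\<pi> | \<pi> permutes I. \<Prod>k\<in>insert a S. \<alpha> (\<pi> k) ^ e k)"
    unfolding F_def using S(1) a by (simp add: mult.commute)
  finally show ?thesis .
qed

locale function_algebra =
  fixes R :: "('x \<Rightarrow> 'a :: field_char_0) set"
  assumes const [intro]: "(\<lambda>_. a) \<in> R"
    and add [intro]: "f \<in> R \<Longrightarrow> g \<in> R \<Longrightarrow> (\<lambda>x. f x + g x) \<in> R"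
    and mult [intro]: "f \<in> R \<Longrightarrow> g \<in> R \<Longrightarrow> (\<lambda>x. f x * g x) \<in> R"
begin

lemma cmult [intro]: "f \<in> R \<Longrightarrow> (\<lambda>x. a * f x) \<in> R"
  by (rule mult[OF const])

lemma uminus [intro]: "f \<in> R \<Longrightarrow> (\<lambda>x. - f x) \<in> R"
  using cmult[of f "- 1"] by simp

lemma diff [intro]: "f \<in> R \<Longrightarrow> g \<in> R \<Longrightarrow> (\<lambda>x. f x - g x) \<in> R"
  using add[OF _ uminus, of f g] by simp

lemma sum [intro]: "(\<And>i. i \<in> I \<Longrightarrow> f i \<in> R) \<Longrightarrow> (\<lambda>x. \<Sum>i\<in>I. f i x) \<in> R"
  by (induction I rule: infinite_finite_induct) auto

lemma power_sums_if_coeffs: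
  assumes finite_I: "finite I" and coeffs: "\<And>k. (\<lambda>x. coeff (\<Prod>i\<in>I. [:1, - \<mu> i x:]) k) \<in> R"
  shows "(\<lambda>x. \<Sum>i\<in>I. \<mu> i x ^ k) \<in> R"
proof (induction k rule: less_induct)
  case (less k)
  show ?case
  proof (cases k)
    case (Suc k')
    define e where "e l x = coeff (\<Prod>i\<in>I. [:1, - \<mu> i x:]) l" for l x
    have e: "e l \<in> R" for l unfolding e_def by (rule coeffs)
    have "e 0 x = 1" for x by (simp add: e_def poly_0_coeff_0[symmetric] poly_prod)
    moreover have "of_nat k * e k x = - (\<Sum>l\<le>k'. e l x * (\<Sum>i\<in>I. \<mu> i x ^ (k - l)))" for x
      unfolding Suc e_def by (rule newton_identity[OF finite_I])
    moreover have "{..k'} = insert 0 {0<..k'}" by auto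
    ultimately have "(\<Sum>i\<in>I. \<mu> i x ^ k) =
        - (of_nat k * e k x) - (\<Sum>l\<in>{0<..k'}. e l x * (\<Sum>i\<in>I. \<mu> i x ^ (k - l)))" for x
      by simp
    moreover have "(\<lambda>x. \<dots> x) \<in> R"
      using Suc by (intro diff uminus cmult sum mult e less.IH) auto
    ultimately show ?thesis by simp
  qed auto
qed

lemma coeffs_if_power_sums:
  assumes finite_I: "finite I" and sums: "\<And>k. (\<lambda>x. \<Sum>i\<in>I. \<mu> i x ^ k) \<in> R"
  shows "(\<lambda>x. coeff (\<Prod>i\<in>I. [:1, - \<mu> i x:]) k) \<in> R"
proof (induction k rule: less_induct)
  case (less k)
  show ?case
  proof (cases k)
    case 0
    thus ?thesis by (auto simp: poly_0_coeff_0[symmetric] poly_prod)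
  next
    case (Suc k')
    define e where "e l x = coeff (\<Prod>i\<in>I. [:1, - \<mu> i x:]) l" for l x
    have "of_nat k * e k x = - (\<Sum>l\<le>k'. e l x * (\<Sum>i\<in>I. \<mu> i x ^ (k - l)))" for x
      unfolding Suc e_def by (rule newton_identity[OF finite_I])
    hence "e k x = - (1 / of_nat k) * (\<Sum>l\<le>k'. e l x * (\<Sum>i\<in>I. \<mu> i x ^ (k - l)))" for x
      using Suc by (simp add: field_simps del: of_nat_Suc)
    moreover have "(\<lambda>x. \<dots> x) \<in> R"
      using less.IH Suc by (intro cmult sum mult sums) (auto simp: e_def)
    ultimately show ?thesis by (simp add: e_def)
  qed
qed

lemma symmetrized_monomial:
  assumes finite_I: "finite I" and sums: "\<And>k. (\<lambda>x. \<Sum>i\<in>I. \<alpha> i x ^ k) \<in> R" and "S \<subseteq> I"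
  shows "(\<lambda>x. \<Sum>\<pi> | \<pi> permutes I. \<Prod>k\<in>S. \<alpha> (\<pi> k) x ^ e k) \<in> R"
  using finite_subset[OF assms(3) finite_I] assms(3)
proof (induction S arbitrary: e)
  case (insert a S)
  define \<Phi> where "\<Phi> S e x = (\<Sum>\<pi> | \<pi> permutes I. \<Prod>k\<in>S. \<alpha> (\<pi> k) x ^ e k)" for S and e :: "_ \<Rightarrow> nat"
    and x
  have "a \<in> I - S" using insert by auto
  hence "card (I - S) \<noteq> 0" using finite_I by auto
  moreover have "\<Phi> S e x * (\<Sum>i\<in>I. \<alpha> i x ^ e a) =
      (\<Sum>b\<in>S. \<Phi> S (e(b := e b + e a)) x) + of_nat (card (I - S)) * \<Phi> (insert a S) e x" for x
    unfolding \<Phi>_def using finite_I insert by (intro sum_permutations_monomial_mult_power_sum) auto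
  ultimately have "\<Phi> (insert a S) e x = (1 / of_nat (card (I - S))) *
      (\<Phi> S e x * (\<Sum>i\<in>I. \<alpha> i x ^ e a) - (\<Sum>b\<in>S. \<Phi> S (e(b := e b + e a)) x))" for x
    by simp
  moreover have "\<Phi> S e \<in> R" for e unfolding \<Phi>_def using insert by blast
  hence "(\<lambda>x. (1 / of_nat (card (I - S))) *
      (\<Phi> S e x * (\<Sum>i\<in>I. \<alpha> i x ^ e a) - (\<Sum>b\<in>S. \<Phi> S (e(b := e b + e a)) x))) \<in> R"
    by (intro cmult diff mult sum sums)
  ultimately show ?case unfolding \<Phi>_def by simp
qed auto

lemma symmetrized_linear_form_power:
  assumes finite_I: "finite I" and sums: "\<And>k. (\<lambda>x. \<Sum>i\<in>I. \<alpha> i x ^ k) \<in> R"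
  shows "(\<lambda>x. \<Sum>\<pi> | \<pi> permutes I. (\<Sum>k\<in>I. c k * \<alpha> (\<pi> k) x) ^ q) \<in> R"
proof -
  define \<Phi> where "\<Phi> q e x = (\<Sum>\<pi> | \<pi> permutes I.
    (\<Sum>k\<in>I. c k * \<alpha> (\<pi> k) x) ^ q * (\<Prod>k\<in>I. \<alpha> (\<pi> k) x ^ e k))" for q and e :: "_ \<Rightarrow> nat" and x
  have "\<Phi> q e \<in> R" for e
  proof (induction q arbitrary: e)
    case 0
    show ?case using symmetrized_monomial[OF assms order_refl] by (simp add: \<Phi>_def)
  next
    case (Suc q)
    have shift: "\<alpha> (\<pi> b) x * (\<Prod>k\<in>I. \<alpha> (\<pi> k) x ^ e k) = (\<Prod>k\<in>I. \<alpha> (\<pi> k) x ^ (e(b := Suc (e b))) k)"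
      if "b \<in> I" for \<pi> b x
      using finite_I that by (simp add: prod.remove mult.assoc)
    have "\<Phi> (Suc q) e x = (\<Sum>\<pi> | \<pi> permutes I. \<Sum>b\<in>I. c b *
        ((\<Sum>k\<in>I. c k * \<alpha> (\<pi> k) x) ^ q * (\<alpha> (\<pi> b) x * (\<Prod>k\<in>I. \<alpha> (\<pi> k) x ^ e k))))" for x
      unfolding \<Phi>_def by (simp add: sum_distrib_left sum_distrib_right mult_ac)
    also have "\<And>x. \<dots> x = (\<Sum>b\<in>I. c b * \<Phi> q (e(b := Suc (e b))) x)"
      unfolding \<Phi>_def sum_distrib_left by (subst sum.swap) (simp add: shift del: fun_upd_apply)
    finally have "\<Phi> (Suc q) e = (\<lambda>x. \<Sum>b\<in>I. c b * \<Phi> q (e(b := Suc (e b))) x)" by (rule ext)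
    thus ?case by (simp only:) (intro sum cmult Suc.IH)
  qed
  from this[of "\<lambda>_. 0"] show ?thesis by (simp add: \<Phi>_def[abs_def])
qed

end

section \<open>Resultants and Bezout's theorem\<close>

lemma sum_shifted_coeffs:
  fixes p :: "'a :: comm_semiring_1 poly"
  assumes "degree p + i < N"
  shows "(\<Sum>j<N. (if i \<le> j \<and> j - i \<le> degree p then coeff p (degree p + i - j) else 0) *
      t ^ (N - 1 - j)) =
    t ^ (N - 1 - (degree p + i)) * poly p t"
proof -
  have "(\<Sum>j<N. (if i \<le> j \<and> j - i \<le> degree p then coeff p (degree p + i - j) else 0) *
      t ^ (N - 1 - j)) =
      (\<Sum>j\<in>{i..degree p + i}. coeff p (degree p + i - j) * t ^ (N - 1 - j))"
    using assms by (intro sum.mono_neutral_cong_right) auto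
  also have "\<dots> = (\<Sum>l\<le>degree p. coeff p l * t ^ (N - 1 - (degree p + i) + l))"
    using assms
    by (intro sum.reindex_bij_witness[where i="\<lambda>l. degree p + i - l" and j="\<lambda>j. degree p + i - j"])
      (auto intro!: arg_cong2[of _ _ _ _ "(*)"] arg_cong[of _ _ "power t"])
  also have "\<dots> = t ^ (N - 1 - (degree p + i)) * poly p t"
    by (simp add: poly_altdef sum_distrib_left power_add mult_ac)
  finally show ?thesis .
qed

lemma sylvester_mat_row_power_sum:
  fixes f g :: "'a :: comm_semiring_1 poly"
  assumes i: "i < degree f + degree g"
  shows "(\<Sum>j<degree f + degree g. sylvester_mat f g $$ (i, j) * t ^ (degree f + degree g - 1 - j)) =
    (if i < degree g then t ^ (degree g - 1 - i) * poly f t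
     else t ^ (degree f + degree g - 1 - i) * poly g t)"
proof (cases "i < degree g")
  case True
  have "sylvester_mat f g $$ (i, j) =
      (if i \<le> j \<and> j - i \<le> degree f then coeff f (degree f + i - j) else 0)"
    if "j < degree f + degree g" for j
    using True i that by (simp add: sylvester_index_mat)
  moreover have "degree f + i < degree f + degree g" using True by simp
  from sum_shifted_coeffs[OF this, of t]
  have "(\<Sum>j<degree f + degree g.
      (if i \<le> j \<and> j - i \<le> degree f then coeff f (degree f + i - j) else 0) *
        t ^ (degree f + degree g - 1 - j)) = t ^ (degree g - 1 - i) * poly f t"
    by simp
  ultimately show ?thesis using True by simp
next
  case False
  have "sylvester_mat f g $$ (i, j) = (if i - degree g \<le> j \<and> j - (i - degree g) \<le> degree g
      then coeff g (degree g + (i - degree g) - j) else 0)"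
    if "j < degree f + degree g" for j
    using False i that by (auto simp: sylvester_index_mat)
  moreover have "degree g + (i - degree g) < degree f + degree g" using False i by simp
  from sum_shifted_coeffs[OF this, of t]
  have "(\<Sum>j<degree f + degree g. (if i - degree g \<le> j \<and> j - (i - degree g) \<le> degree g
      then coeff g (degree g + (i - degree g) - j) else 0) * t ^ (degree f + degree g - 1 - j)) =
      t ^ (degree f + degree g - 1 - i) * poly g t"
    using False by simp
  ultimately show ?thesis using False by simp
qed

lemma det_vandermonde_neq_0:
  fixes ts :: "'a :: idom list"
  assumes "distinct ts" "length ts = N"
  shows "det (Matrix.mat N N (\<lambda>(j, l). ts ! l ^ (N - 1 - j))) \<noteq> 0"
proof
  let ?V = "Matrix.mat N N (\<lambda>(j, l). ts ! l ^ (N - 1 - j))"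
  assume "det ?V = 0"
  hence "det (transpose_mat ?V) = 0" by (subst det_transpose) auto
  then obtain v where v: "v \<in> carrier_vec N" "v \<noteq> 0\<^sub>v N" "transpose_mat ?V *\<^sub>v v = 0\<^sub>v N"
    using det_0_iff_vec_prod_zero[of "transpose_mat ?V" N] by auto
  define p where "p = (\<Sum>j<N. monom (v $ j) (N - 1 - j))"
  have "N > 0" using v(1,2) by (cases N) auto
  moreover have "degree p \<le> N - 1"
    unfolding p_def by (rule degree_sum_le) (auto intro: order.trans[OF degree_monom_le])
  ultimately have "degree p < card (set ts)" using assms by (simp add: distinct_card)
  moreover have "poly p (ts ! l) = 0" if "l < N" for l
  proof -
    have "0 = (transpose_mat ?V *\<^sub>v v) $ l" using v(3) that by simp
    also have "\<dots> = poly p (ts ! l)"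
      using that v(1) unfolding p_def poly_sum
      by (auto simp: scalar_prod_def poly_monom mult.commute atLeast0LessThan intro!: sum.cong)
    finally show ?thesis by simp
  qed
  hence "poly p a = 0" if "a \<in> set ts" for a
    using that assms(2) by (metis in_set_conv_nth)
  ultimately have "p = 0" using poly_eqI_degree[of "set ts" p 0] by force
  have "v $ i = 0" if "i < N" for i
  proof -
    have "coeff p (N - 1 - i) = (\<Sum>j<N. if j = i then v $ j else 0)"
      unfolding p_def coeff_sum using that by (intro sum.cong) auto
    thus ?thesis using that \<open>p = 0\<close> by simp
  qed
  hence "v = 0\<^sub>v N" using v(1) by (intro eq_vecI) auto
  thus False using v(2) by simp
qed

lemma power_card_dvd_det:
  fixes M :: "'a :: comm_ring_1 mat"
  assumes M: "M \<in> carrier_mat N N" and J: "J \<subseteq> {..<N}"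
    and cols: "\<And>i j. i < N \<Longrightarrow> j \<in> J \<Longrightarrow> d dvd M $$ (i, j)"
  shows "d ^ card J dvd det M"
proof -
  have "d ^ card J dvd (\<Prod>j<N. M $$ (p j, j))" if p: "p permutes {0..<N}" for p
  proof -
    have "p j < N" if "j \<in> J" for j using permutes_in_image[OF p, of j] that J by auto
    hence "(\<Prod>j\<in>J. d) dvd (\<Prod>j\<in>J. M $$ (p j, j))" by (intro prod_dvd_prod cols)
    also have "\<dots> dvd (\<Prod>j<N. M $$ (p j, j))" using J by (intro prod_dvd_prod_subset) auto
    finally show ?thesis by simp
  qed
  thus ?thesis unfolding det_col[OF M] by (intro dvd_sum dvd_mult) auto
qed

lemma degree_det_le_weights:
  fixes M :: "'a :: idom poly mat"
  assumes M: "M \<in> carrier_mat N N"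
    and entries: "\<And>i j. i < N \<Longrightarrow> j < N \<Longrightarrow> M $$ (i, j) \<noteq> 0 \<Longrightarrow> degree (M $$ (i, j)) + a i \<le> b j"
    and weights: "(\<Sum>j<N. b j) \<le> (\<Sum>i<N. a i) + d"
  shows "degree (det M) \<le> d"
proof -
  have "degree (of_int (sign p) * (\<Prod>i = 0..<N. M $$ (i, p i))) \<le> d" if p: "p permutes {0..<N}" for p
  proof (cases "\<exists>i\<in>{0..<N}. M $$ (i, p i) = 0")
    case True
    hence "(\<Prod>i = 0..<N. M $$ (i, p i)) = 0" by (intro prod_zero) auto
    thus ?thesis by (simp only: mult_zero_right degree_0)
  next
    case False
    have "p i < N" if "i < N" for i using permutes_in_image[OF p, of i] that by auto
    hence "degree (M $$ (i, p i)) + a i \<le> b (p i)" if "i < N" for i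
      using that False by (intro entries) auto
    hence "(\<Sum>i<N. degree (M $$ (i, p i)) + a i) \<le> (\<Sum>i<N. b (p i))" by (intro sum_mono) auto
    also have "\<dots> = (\<Sum>j<N. b j)"
      using sum.permute[OF p, of b] by (simp add: comp_def atLeast0LessThan)
    finally have "(\<Sum>i<N. degree (M $$ (i, p i))) \<le> d" using weights by (simp add: sum.distrib)
    hence "degree (\<Prod>i = 0..<N. M $$ (i, p i)) \<le> d"
      using degree_prod_sum_le[of "{0..<N}" "\<lambda>i. M $$ (i, p i)"] by (simp add: atLeast0LessThan)
    thus ?thesis by (auto simp: sign_def)
  qed
  thus ?thesis unfolding det_def'[OF M] by (intro degree_sum_le) (auto simp: finite_permutations)
qed

lemma resultant_eq_0_iff_common_root:
  fixes f g :: "complex poly"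
  assumes "f \<noteq> 0"
  shows "resultant f g = 0 \<longleftrightarrow> (\<exists>t. poly f t = 0 \<and> poly g t = 0)"
proof -
  have "gcd f g \<noteq> 0" using assms by simp
  hence "degree (gcd f g) \<noteq> 0 \<longleftrightarrow> (\<exists>t. poly (gcd f g) t = 0)"
    using fundamental_theorem_of_algebra[of "gcd f g"]
    by (auto simp: constant_degree elim!: degree_eq_zeroE)
  thus ?thesis unfolding resultant_0_gcd poly_eq_0_iff_dvd by simp
qed

lemma irreducible_dvd_if_resultant_eq_0:
  fixes f g :: "'a :: {factorial_ring_gcd, semiring_gcd_mult_normalize} poly"
  assumes "irreducible f" "resultant f g = 0"
  shows "f dvd g"
proof -
  have "\<not> is_unit (gcd f g)" using assms(2) unfolding resultant_0_gcd
    by (auto simp: is_unit_poly_iff)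
  hence "f dvd gcd f g" using assms(1) irreducibleD'[of f "gcd f g"] by simp
  thus ?thesis by simp
qed

definition eval2 :: "'a :: comm_ring_1 \<Rightarrow> 'a \<Rightarrow> 'a poly poly \<Rightarrow> 'a" where
  "eval2 x y p = poly (poly p [:y:]) x"

interpretation eval2: comm_ring_hom "eval2 x y" for x y :: "'a :: comm_ring_1"
  by unfold_locales (auto simp: eval2_def)

lemma eval2_eq_poly_map_poly: "eval2 x y p = poly (map_poly (\<lambda>q. poly q x) p) y"
  by (induction p) (simp_all add: eval2_def map_poly_pCons)

definition total_degree_le :: "'a :: zero poly poly \<Rightarrow> nat \<Rightarrow> bool" where
  "total_degree_le p k \<longleftrightarrow> (\<forall>i. coeff p i \<noteq> 0 \<longrightarrow> degree (coeff p i) + i \<le> k)"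

lemma degree_resultant_le:
  fixes f g :: "'a :: idom poly poly"
  assumes f: "total_degree_le f (degree f)" and g: "total_degree_le g (degree g)"
  shows "degree (resultant f g) \<le> degree f * degree g"
proof -
  define m n where "m = degree f" and "n = degree g"
  define a where "a i = (if i < n then i else i - n)" for i
  have "degree (sylvester_mat f g $$ (i, j)) + a i \<le> j"
    if ij: "i < m + n" "j < m + n" and nonzero: "sylvester_mat f g $$ (i, j) \<noteq> 0" for i j
  proof (cases "i < n")
    case True
    hence "i \<le> j" "j - i \<le> m" "sylvester_mat f g $$ (i, j) = coeff f (m + i - j)"
      using ij nonzero by (auto simp: sylvester_index_mat m_def n_def split: if_splits)
    moreover have "degree (coeff f (m + i - j)) + (m + i - j) \<le> m"
      using f nonzero calculation(3) unfolding total_degree_le_def m_def by metis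
    ultimately show ?thesis using True by (simp add: a_def)
  next
    case False
    hence "i - n \<le> j" "j \<le> i" "sylvester_mat f g $$ (i, j) = coeff g (i - j)"
      using ij nonzero by (auto simp: sylvester_index_mat m_def n_def split: if_splits)
    moreover have "degree (coeff g (i - j)) + (i - j) \<le> n"
      using g nonzero calculation(3) unfolding total_degree_le_def n_def by metis
    ultimately show ?thesis using False by (simp add: a_def)
  qed
  moreover have "(\<Sum>j<m+n. j) = (\<Sum>i<m+n. a i) + m * n"
  proof -
    have split: "(\<Sum>i<m+n. h i) = (\<Sum>i<n. h i) + (\<Sum>i<m. h (n + i))" for h :: "nat \<Rightarrow> nat"
      using sum.atLeastLessThan_concat[of 0 n "m + n" h] sum.shift_bounds_nat_ivl[of h 0 n m]
      by (simp add: atLeast0LessThan add.commute)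
    show ?thesis by (simp add: split a_def sum.distrib)
  qed
  ultimately show ?thesis
    unfolding resultant_def m_def n_def
    by (intro degree_det_le_weights[OF sylvester_carrier_mat, where a=a and b="\<lambda>j. j"]) auto
qed

lemma ex_distinct_list_of_length_superset:
  fixes T :: "'a set"
  assumes "infinite (UNIV :: 'a set)" and T: "finite T" "card T \<le> N"
  obtains ts where "distinct ts" "length ts = N" "T \<subseteq> set ts"
proof -
  obtain U where U: "finite U" "card U = N - card T" "T \<inter> U = {}"
    using finite_arbitrarily_large_disj[OF assms(1) T(1)] by blast
  obtain ts where ts: "set ts = T \<union> U" "distinct ts"
    using finite_distinct_list[of "T \<union> U"] T(1) U(1) by auto
  have "length ts = N"
    using distinct_card[OF ts(2)] card_Un_disjoint[OF T(1) U(1,3)] T(2) U(2) ts(1) by simp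
  thus ?thesis using that ts by blast
qed

text \<open>Multiplying the Sylvester matrix by an invertible Vandermonde matrix some of whose nodes are
  the elements of \<open>T\<close> makes the corresponding columns divisible by \<open>X - x\<close>.\<close>
lemma power_card_dvd_resultant:
  fixes f g :: "'a :: field_char_0 poly poly"
  assumes T: "finite T" "card T \<le> degree f + degree g"
    and zeros: "\<And>t. t \<in> T \<Longrightarrow> eval2 x t f = 0 \<and> eval2 x t g = 0"
  shows "[:- x, 1:] ^ card T dvd resultant f g"
proof -
  define N where "N = degree f + degree g"
  obtain ts where ts: "distinct ts" "length ts = N" "T \<subseteq> set ts"
    using ex_distinct_list_of_length_superset[OF infinite_UNIV_char_0 T(1)] T(2) unfolding N_def
    by blast
  define J where "J = {l. l < N \<and> ts ! l \<in> T}"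
  define V where "V = map_mat (\<lambda>c. [:c:]) (Matrix.mat N N (\<lambda>(j, l). ts ! l ^ (N - 1 - j)))"
  have S: "sylvester_mat f g \<in> carrier_mat N N" unfolding N_def by (rule sylvester_carrier_mat)
  have V: "V \<in> carrier_mat N N" by (simp add: V_def)
  have "[:- x, 1:] dvd (sylvester_mat f g * V) $$ (i, l)" if "i < N" "l \<in> J" for i l
  proof -
    have "(sylvester_mat f g * V) $$ (i, l) =
        (\<Sum>j<N. sylvester_mat f g $$ (i, j) * [:ts ! l:] ^ (N - 1 - j))"
      using that S
      by (auto simp: J_def V_def scalar_prod_def atLeast0LessThan poly_const_pow intro!: sum.cong)
    also have "\<dots> = (if i < degree g then [:ts ! l:] ^ (degree g - 1 - i) * poly f [:ts ! l:]
        else [:ts ! l:] ^ (N - 1 - i) * poly g [:ts ! l:])"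
      using that(1) unfolding N_def by (rule sylvester_mat_row_power_sum)
    finally show ?thesis
      using zeros[of "ts ! l"] that(2)
      by (auto simp: J_def eval2_def poly_eq_0_iff_dvd intro: dvd_mult)
  qed
  hence "[:- x, 1:] ^ card J dvd det (sylvester_mat f g * V)"
    by (intro power_card_dvd_det[OF mult_carrier_mat[OF S V]]) (auto simp: J_def)
  moreover have "card J = card T"
  proof -
    have "nth ts ` J = T" using ts(2,3) by (force simp: J_def in_set_conv_nth)
    moreover have "inj_on (nth ts) J" using ts(1,2)
      by (auto simp: J_def inj_on_def nth_eq_iff_index_eq)
    ultimately show ?thesis by (metis card_image)
  qed
  moreover have "is_unit (det V)"
    unfolding V_def coeff_lift_hom.hom_det using det_vandermonde_neq_0[OF ts(1,2)]
    by (simp add: is_unit_const_poly_iff)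
  ultimately show ?thesis unfolding det_mult[OF S V] resultant_def by (metis dvd_mult_unit_iff)
qed

lemma card_common_zeros_le_order_resultant:
  fixes f g :: "'a :: field_char_0 poly poly" and x :: 'a
  assumes "lead_coeff f = 1" "resultant f g \<noteq> 0"
  defines "T \<equiv> {t. eval2 x t f = 0 \<and> eval2 x t g = 0}"
  shows "finite T" "card T \<le> Polynomial.order x (resultant f g)"
proof -
  define h where "h = map_poly (\<lambda>p. poly p x) f"
  have "coeff h (degree f) = 1" using assms(1) by (simp add: h_def)
  hence h_nonzero: "h \<noteq> 0" by auto
  have T_subset: "T \<subseteq> {t. poly h t = 0}" by (auto simp: T_def h_def eval2_eq_poly_map_poly)
  show finite_T: "finite T" by (rule finite_subset[OF T_subset poly_roots_finite[OF h_nonzero]])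
  have "card T \<le> card {t. poly h t = 0}"
    by (rule card_mono[OF poly_roots_finite[OF h_nonzero] T_subset])
  also have "\<dots> \<le> degree h" by (rule card_poly_roots_bound[OF h_nonzero])
  also have "\<dots> \<le> degree f" unfolding h_def by (rule degree_map_poly_le)
  finally have "[:- x, 1:] ^ card T dvd resultant f g"
    using finite_T by (intro power_card_dvd_resultant) (auto simp: T_def)
  thus "card T \<le> Polynomial.order x (resultant f g)" using assms(2) unfolding order_divides by simp
qed

theorem bezout_affine:
  fixes f g :: "'a :: field_char_0 poly poly"
  assumes "total_degree_le f (degree f)" "total_degree_le g (degree g)"
    and monic: "lead_coeff f = 1"
    and P: "finite P" "card P > degree f * degree g"
    and zeros: "\<And>x t. (x, t) \<in> P \<Longrightarrow> eval2 x t f = 0 \<and> eval2 x t g = 0"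
  shows "resultant f g = 0"
proof (rule ccontr)
  assume nonzero: "resultant f g \<noteq> 0"
  let ?r = "resultant f g"
  have card_le: "card (P `` {x}) \<le> Polynomial.order x ?r" for x
  proof -
    have "card (P `` {x}) \<le> card {t. eval2 x t f = 0 \<and> eval2 x t g = 0}"
      using zeros
      by (intro card_mono card_common_zeros_le_order_resultant(1)[OF monic nonzero]) auto
    thus ?thesis
      using card_common_zeros_le_order_resultant(2)[OF monic nonzero] by (rule order.trans)
  qed
  have "poly ?r x = 0" if "x \<in> fst ` P" for x
  proof -
    have "card (P `` {x}) \<noteq> 0" using that P(1) by (auto simp: card_eq_0_iff)
    hence "Polynomial.order x ?r \<noteq> 0" using card_le[of x] by linarith
    thus ?thesis unfolding order_root by blast
  qed
  hence roots: "fst ` P \<subseteq> {x. poly ?r x = 0}" by blast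
  have "P = (SIGMA x:fst ` P. P `` {x})" by force
  hence "card P = card (SIGMA x:fst ` P. P `` {x})" by (rule arg_cong)
  also have "\<dots> = (\<Sum>x\<in>fst ` P. card (P `` {x}))" using P(1) by (intro card_SigmaI) auto
  also have "\<dots> \<le> (\<Sum>x\<in>fst ` P. Polynomial.order x ?r)" by (rule sum_mono) (rule card_le)
  also have "\<dots> \<le> (\<Sum>x | poly ?r x = 0. Polynomial.order x ?r)"
    by (rule sum_mono2[OF poly_roots_finite[OF nonzero] roots]) simp
  also have "\<dots> \<le> degree ?r" by (rule sum_order_le_degree[OF nonzero])
  also have "\<dots> \<le> degree f * degree g" by (rule degree_resultant_le) fact+
  finally show False using P(2) by simp
qed

section \<open>Homogeneous polynomials in three variables\<close>

lemma (in comm_ring_hom) degree_map_poly_monic: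
  "lead_coeff p = 1 \<Longrightarrow> degree (map_poly hom p) = degree p"
  by (rule Ring_Hom_Poly.degree_map_poly) auto

lemma (in comm_ring_hom) lead_coeff_map_poly_monic:
  "lead_coeff p = 1 \<Longrightarrow> lead_coeff (map_poly hom p) = 1"
  by (simp add: degree_map_poly_monic)

lemma (in comm_ring_hom) resultant_map_poly_monic:
  assumes "lead_coeff p = 1" "lead_coeff q = 1"
  shows "resultant (map_poly hom p) (map_poly hom q) = hom (resultant p q)"
  using assms by (intro resultant_map_poly degree_map_poly_monic)

lemma poly_eq_0_if_infinite_zeros:
  fixes p :: "'a :: idom poly"
  assumes "infinite S" "\<And>s. s \<in> S \<Longrightarrow> poly p s = 0"
  shows "p = 0"
  using assms poly_roots_finite[of p] finite_subset[of S "{x. poly p x = 0}"] by blast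

lemma eval2_eq_0_imp_eq_0:
  fixes p :: "'a :: field_char_0 poly poly"
  assumes "\<And>x y. y \<noteq> 0 \<Longrightarrow> eval2 x y p = 0"
  shows "p = 0"
proof (rule poly_eq_0_if_infinite_zeros)
  have "inj (\<lambda>y :: 'a. [:y:])" by (auto intro: injI)
  thus "infinite ((\<lambda>y :: 'a. [:y:]) ` (- {0}))"
    by (simp add: finite_image_iff inj_on_subset finite_compl infinite_UNIV_char_0)
  fix s assume "s \<in> (\<lambda>y :: 'a. [:y:]) ` (- {0})"
  then obtain y where y: "y \<noteq> 0" "s = [:y:]" by auto
  show "poly p s = 0"
    by (rule poly_eq_0_if_infinite_zeros[OF infinite_UNIV_char_0])
      (use assms[OF y(1)] y(2) in \<open>simp add: eval2_def\<close>)
qed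

lemma eval3_eq_poly_map_poly: "eval3 q x y t = poly (map_poly (eval2 x y) q) t"
proof -
  have "eval3 q x y t = eval2 x y (poly q [:[:t:]:])" by (simp add: eval3_def eval2_def)
  also have "\<dots> = poly (map_poly (eval2 x y) q) (eval2 x y [:[:t:]:])"
    by (rule eval2.poly_map_poly[symmetric])
  finally show ?thesis by (simp add: eval2_def)
qed

lemma map_poly_eval2_inject:
  fixes p q :: "'a :: field_char_0 poly poly poly"
  assumes "\<And>x y. map_poly (eval2 x y) p = map_poly (eval2 x y) q"
  shows "p = q"
proof (rule poly_eqI)
  fix i
  have "eval2 x y (coeff p i - coeff q i) = 0" for x y
    using arg_cong[OF assms[of x y], of "\<lambda>p. coeff p i"] by (simp add: eval2.hom_minus)
  from eval2_eq_0_imp_eq_0[OF this] show "coeff p i = coeff q i" by simp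
qed

definition homogeneous3 :: "nat \<Rightarrow> complex poly poly poly \<Rightarrow> bool" where
  "homogeneous3 k q \<longleftrightarrow>
    (\<forall>s x y t. s \<noteq> 0 \<longrightarrow> eval3 q (s * x) (s * y) (s * t) = s ^ k * eval3 q x y t)"

lemma homogeneous3_scale_eq_0_iff:
  assumes "homogeneous3 k q" "s \<noteq> 0"
  shows "eval3 q (s * x) (s * y) (s * t) = 0 \<longleftrightarrow> eval3 q x y t = 0"
  using assms unfolding homogeneous3_def by simp

lemma homogeneous3_eval2_coeff:
  assumes "homogeneous3 k q" and s: "s \<noteq> 0"
  shows "s ^ i * eval2 (s * x) (s * y) (coeff q i) = s ^ k * eval2 x y (coeff q i)"
proof -
  have "pcompose (map_poly (eval2 (s * x) (s * y)) q) [:0, s:] =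
      Polynomial.smult (s ^ k) (map_poly (eval2 x y) q)"
    using assms(1) s unfolding homogeneous3_def eval3_eq_poly_map_poly
    by (simp add: poly_eq_poly_eq_iff[symmetric] fun_eq_iff poly_pcompose mult.commute[of _ s])
  from arg_cong[OF this, of "\<lambda>p. coeff p i"] show ?thesis by (simp add: coeff_pcompose_linear)
qed

lemma degree_le_if_reciprocal:
  fixes a b :: "'a :: field_char_0 poly"
  assumes "a \<noteq> 0" and reciprocal: "\<And>x. x \<noteq> 0 \<Longrightarrow> x ^ i * poly a x = x ^ k * poly b (inverse x)"
  shows "degree a + i \<le> k"
proof -
  have "poly (monom 1 (degree b + i) * a - monom 1 k * reflect_poly b) x = 0" if "x \<noteq> 0" for x
    using reciprocal[OF that] that by (simp add: poly_monom poly_reflect_poly_nz power_add mult_ac)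
  hence "monom 1 (degree b + i) * a - monom 1 k * reflect_poly b = 0"
    by (intro poly_eq_0_if_infinite_zeros[of "- {0}"])
      (auto simp: infinite_UNIV_char_0 finite_compl)
  hence product_eq: "monom 1 (degree b + i) * a = monom 1 k * reflect_poly b" by simp
  have "degree b + i + degree a = degree (monom 1 (degree b + i) * a)"
    using assms(1) by (simp add: degree_mult_eq degree_monom_eq)
  also have "\<dots> \<le> degree (monom 1 k :: 'a poly) + degree (reflect_poly b)"
    unfolding product_eq by (rule degree_mult_le)
  also have "\<dots> \<le> k + degree b" by (simp add: degree_monom_eq degree_reflect_poly_le)
  finally show ?thesis by simp
qed

abbreviation dehomogenize :: "'a :: comm_ring_1 poly poly poly \<Rightarrow> 'a poly poly" where
  "dehomogenize \<equiv> map_poly (\<lambda>p. poly p 1)"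

lemma eval2_dehomogenize: "eval2 x t (dehomogenize q) = eval3 q x 1 t"
  using eval2_eq_poly_map_poly[of 1 "[:t:]" q] by (simp add: eval2_def eval3_def)

lemma total_degree_le_dehomogenize:
  assumes "homogeneous3 k q"
  shows "total_degree_le (dehomogenize q) k"
  unfolding total_degree_le_def
proof (intro allI impI)
  fix i
  let ?a = "coeff (dehomogenize q) i" and ?b = "map_poly (\<lambda>p. poly p 1) (coeff q i)"
  assume "?a \<noteq> 0"
  moreover have "x ^ i * poly ?a x = x ^ k * poly ?b (inverse x)" if "x \<noteq> 0" for x
    using homogeneous3_eval2_coeff[OF assms that, of i 1 "inverse x"] that
    by (simp add: coeff_map_poly eval2_eq_poly_map_poly[symmetric]) (simp add: eval2_def)
  ultimately show "degree ?a + i \<le> k" by (rule degree_le_if_reciprocal)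
qed

theorem bezout_homogeneous:
  fixes f g :: "complex poly poly poly"
  assumes f: "homogeneous3 (degree f) f" "lead_coeff f = 1"
    and g: "homogeneous3 (degree g) g" "lead_coeff g = 1"
    and P: "finite P" "card P > degree f * degree g"
    and zeros: "\<And>x t. (x, t) \<in> P \<Longrightarrow> eval3 f x 1 t = 0 \<and> eval3 g x 1 t = 0"
  shows "resultant f g = 0"
proof (rule eval2_eq_0_imp_eq_0)
  fix x y :: complex assume y: "y \<noteq> 0"
  have res_hom: "resultant (map_poly (eval2 x y) f) (map_poly (eval2 x y) g) =
      eval2 x y (resultant f g)" for x y
    using f(2) g(2) by (rule eval2.resultant_map_poly_monic)
  have nonzero: "map_poly (eval2 x y) f \<noteq> 0" for x y
    using eval2.lead_coeff_map_poly_monic[OF f(2), of x y]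
    by (metis leading_coeff_0_iff zero_neq_one)
  note degree_dehomogenize = poly_hom.degree_map_poly_monic[OF f(2)]
    poly_hom.degree_map_poly_monic[OF g(2)]
  have "resultant (dehomogenize f) (dehomogenize g) = 0"
    by (rule bezout_affine[OF _ _ _ P(1)])
      (use P(2) zeros f(2) degree_dehomogenize total_degree_le_dehomogenize[OF f(1)]
          total_degree_le_dehomogenize[OF g(1)] in \<open>auto simp: eval2_dehomogenize\<close>)
  hence "poly (resultant f g) 1 = 0" by (simp add: poly_hom.resultant_map_poly_monic f(2) g(2))
  hence "eval2 (x / y) 1 (resultant f g) = 0" by (simp add: eval2_def)
  then obtain t where t: "eval3 f (x / y) 1 t = 0" "eval3 g (x / y) 1 t = 0"
    using resultant_eq_0_iff_common_root[OF nonzero]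
    unfolding res_hom[symmetric] eval3_eq_poly_map_poly by blast
  have "eval3 f x y (y * t) = 0" "eval3 g x y (y * t) = 0"
    using y t homogeneous3_scale_eq_0_iff[OF f(1) y, of "x / y" 1 t]
      homogeneous3_scale_eq_0_iff[OF g(1) y, of "x / y" 1 t] by simp_all
  thus "eval2 x y (resultant f g) = 0"
    unfolding res_hom[symmetric] resultant_eq_0_iff_common_root[OF nonzero] eval3_eq_poly_map_poly
    by blast
qed

section \<open>Supporting lines of planar sets\<close>

definition halfplane_intersection :: "real set \<Rightarrow> (real \<Rightarrow> real) \<Rightarrow> complex set" where
  "halfplane_intersection \<Theta> h = (\<Inter>\<theta>\<in>\<Theta>. {v. Re (cis \<theta> * v) \<le> h \<theta>})"

lemma closed_halfplane_intersection: "closed (halfplane_intersection \<Theta> h)"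
  unfolding halfplane_intersection_def
  by (intro closed_INT ballI closed_Collect_le continuous_intros)

lemma halfplane_intersection_limit_le:
  assumes "v \<in> halfplane_intersection \<Theta> h" "\<And>k. \<phi> k \<in> \<Theta>"
    and "\<phi> \<longlonglongrightarrow> \<theta>" "(\<lambda>k. h (\<phi> k)) \<longlonglongrightarrow> r"
  shows "Re (cis \<theta> * v) \<le> r"
proof (rule LIMSEQ_le)
  show "(\<lambda>k. Re (cis (\<phi> k) * v)) \<longlonglongrightarrow> Re (cis \<theta> * v)"
    using assms(3) by (intro tendsto_intros)
  show "\<exists>N. \<forall>k\<ge>N. Re (cis (\<phi> k) * v) \<le> h (\<phi> k)"
    using assms(1,2) unfolding halfplane_intersection_def by auto
qed (rule assms(4))

lemma frontier_halfplane_intersection_nearly_attained: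
  assumes z: "z \<in> frontier (halfplane_intersection \<Theta> h)" and \<epsilon>: "\<epsilon> > 0"
  shows "\<exists>\<theta>\<in>\<Theta>. h \<theta> < Re (cis \<theta> * z) + \<epsilon>"
proof (rule ccontr)
  assume far: "\<not> ?thesis"
  have "ball z \<epsilon> \<subseteq> halfplane_intersection \<Theta> h"
    unfolding halfplane_intersection_def
  proof (intro subsetI INT_I CollectI)
    fix v \<theta> assume v: "v \<in> ball z \<epsilon>" and \<theta>: "\<theta> \<in> \<Theta>"
    have "Re (cis \<theta> * v) - Re (cis \<theta> * z) = Re (cis \<theta> * (v - z))" by (simp add: right_diff_distrib)
    also have "\<dots> \<le> cmod (cis \<theta> * (v - z))" by (rule complex_Re_le_cmod)
    also have "\<dots> = cmod (v - z)" by (simp add: norm_mult)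
    also have "\<dots> < \<epsilon>" using v by (simp add: dist_norm norm_minus_commute)
    finally show "Re (cis \<theta> * v) \<le> h \<theta>" using far \<theta> by force
  qed
  hence "z \<in> interior (halfplane_intersection \<Theta> h)" using \<epsilon> by (intro interiorI[of "ball z \<epsilon>"]) auto
  thus False using z by (simp add: frontier_def)
qed

lemma frontier_halfplane_intersection_limit_direction:
  assumes "bounded \<Theta>" and z: "z \<in> frontier (halfplane_intersection \<Theta> h)"
  obtains \<phi> \<theta> where "\<And>k. \<phi> k \<in> \<Theta>" "\<phi> \<longlonglongrightarrow> \<theta>" "(\<lambda>k. h (\<phi> k)) \<longlonglongrightarrow> Re (cis \<theta> * z)"
proof -
  have "\<exists>\<theta>\<in>\<Theta>. h \<theta> < Re (cis \<theta> * z) + inverse (real (Suc k))" for k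
    using z by (rule frontier_halfplane_intersection_nearly_attained) simp
  then obtain \<psi> where \<psi>: "\<And>k. \<psi> k \<in> \<Theta>" "\<And>k. h (\<psi> k) < Re (cis (\<psi> k) * z) + inverse (real (Suc k))"
    by metis
  have "bounded (range \<psi>)" using assms(1) by (rule bounded_subset) (use \<psi>(1) in auto)
  then obtain \<theta> r where r: "strict_mono (r :: nat \<Rightarrow> nat)" "(\<lambda>k. \<psi> (r k)) \<longlonglongrightarrow> \<theta>"
    using bounded_imp_convergent_subsequence[of \<psi>] by (auto simp: comp_def)
  have dir: "(\<lambda>k. Re (cis (\<psi> (r k)) * z)) \<longlonglongrightarrow> Re (cis \<theta> * z)"
    using r(2) by (intro tendsto_intros)
  have "z \<in> halfplane_intersection \<Theta> h"
    using z closed_halfplane_intersection frontier_subset_closed by blast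
  hence "Re (cis (\<psi> (r k)) * z) \<le> h (\<psi> (r k))" for k
    using \<psi>(1)[of "r k"] unfolding halfplane_intersection_def by blast
  moreover have "h (\<psi> (r k)) \<le> Re (cis (\<psi> (r k)) * z) + inverse (real (Suc (r k)))" for k
    using \<psi>(2) by (rule less_imp_le)
  moreover have "(\<lambda>k. inverse (real (Suc (r k)))) \<longlonglongrightarrow> 0"
    using LIMSEQ_subseq_LIMSEQ[OF LIMSEQ_inverse_real_of_nat r(1)] unfolding comp_def .
  from tendsto_add[OF dir this]
  have "(\<lambda>k. Re (cis (\<psi> (r k)) * z) + inverse (real (Suc (r k)))) \<longlonglongrightarrow> Re (cis \<theta> * z)"
    by simp
  ultimately have "(\<lambda>k. h (\<psi> (r k))) \<longlonglongrightarrow> Re (cis \<theta> * z)"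
    by (rule tendsto_sandwich[OF always_eventually[OF allI] always_eventually[OF allI] dir])
  with \<psi>(1) r(2) show ?thesis by (rule that)
qed

lemma supporting_functional_vanishes_on_tangent:
  assumes f: "f 0 = (0 :: real)" "(f has_real_derivative D) (at 0)" and \<delta>: "\<delta> > 0"
    and graph: "\<And>s. \<bar>s\<bar> < \<delta> \<Longrightarrow> z + u * Complex s (f s) \<in> S"
    and supp: "\<And>v. v \<in> S \<Longrightarrow> Re (w * v) \<le> Re (w * z)"
  shows "Re (w * (u * Complex 1 D)) = 0"
proof -
  define g where "g s = Re (w * u) * s - Im (w * u) * f s" for s
  have g: "g s = Re (w * (u * Complex s (f s)))" for s
    by (simp add: g_def mult.assoc[symmetric])
  have "(g has_real_derivative (Re (w * u) - Im (w * u) * D)) (at 0)"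
    unfolding g_def by (auto intro!: derivative_eq_intros f(2))
  moreover have "g s \<le> g 0" if "\<bar>0 - s\<bar> < \<delta>" for s
  proof -
    have "Re (w * (z + u * Complex s (f s))) \<le> Re (w * z)"
      by (rule supp[OF graph]) (use that in simp)
    hence "g s \<le> 0" unfolding g by (simp add: distrib_left)
    thus ?thesis using f(1) by (simp add: g_def)
  qed
  ultimately have "Re (w * u) - Im (w * u) * D = 0" using DERIV_local_max[of g _ 0 \<delta>] \<delta> by blast
  thus ?thesis by (simp add: mult.assoc[symmetric])
qed

lemma differentiable_boundary_tangent:
  assumes "closed S" "boundary_differentiable_at S z"
  obtains \<tau> where "\<tau> \<noteq> 0" "\<And>w. (\<And>v. v \<in> S \<Longrightarrow> Re (w * v) \<le> Re (w * z)) \<Longrightarrow> Re (w * \<tau>) = 0"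
proof -
  obtain u f e where u: "cmod u = 1" and e: "e > 0"
      and f: "f 0 = (0 :: real)" "f differentiable (at 0)"
    and graph: "frontier S \<inter> ball z e = range (\<lambda>s. z + u * Complex s (f s)) \<inter> ball z e"
    using assms(2) unfolding boundary_differentiable_at_def by blast
  obtain D where D: "(f has_real_derivative D) (at 0)"
    using f(2) by (auto simp: real_differentiable_def)
  have "isCont (\<lambda>s. cmod (Complex s (f s))) 0"
    using DERIV_isCont[OF D] unfolding cmod_def by (auto intro!: continuous_intros)
  hence "((\<lambda>s. cmod (Complex s (f s))) \<longlongrightarrow> 0) (at 0)"
    using f(1) by (simp add: isCont_def complex_norm)
  hence "eventually (\<lambda>s. cmod (Complex s (f s)) < e) (at 0)" using e by (rule order_tendstoD)
  then obtain \<delta> where \<delta>: "\<delta> > 0" "\<And>s. s \<noteq> 0 \<Longrightarrow> \<bar>s\<bar> < \<delta> \<Longrightarrow> cmod (Complex s (f s)) < e"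
    by (auto simp: eventually_at dist_real_def)
  have "z + u * Complex s (f s) \<in> S" if "\<bar>s\<bar> < \<delta>" for s
  proof -
    have "cmod (Complex s (f s)) < e"
      using \<delta>(2)[of s] that e f(1) by (cases "s = 0") (auto simp: complex_norm)
    hence "z + u * Complex s (f s) \<in> ball z e" using u by (simp add: dist_norm norm_mult)
    thus ?thesis using graph assms(1) frontier_subset_closed by blast
  qed
  note tangent = supporting_functional_vanishes_on_tangent[OF f(1) D \<delta>(1) this]
  have "u * Complex 1 D \<noteq> 0" using u by (auto simp: complex_eq_iff[of "Complex 1 D"])
  thus ?thesis by (rule that) (rule tangent)
qed

lemma supporting_functional_unique:
  assumes S: "closed S" "interior S \<noteq> {}" "boundary_differentiable_at S z"
    and norm_eq: "cmod w = cmod w'"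
    and supp: "\<And>v. v \<in> S \<Longrightarrow> Re (w * v) \<le> Re (w * z)" "\<And>v. v \<in> S \<Longrightarrow> Re (w' * v) \<le> Re (w' * z)"
  shows "w = w'"
proof -
  obtain \<tau> where \<tau>: "\<tau> \<noteq> 0" "\<And>w. (\<And>v. v \<in> S \<Longrightarrow> Re (w * v) \<le> Re (w * z)) \<Longrightarrow> Re (w * \<tau>) = 0"
    using differentiable_boundary_tangent S(1,3) by blast
  have Re_0: "Re (w * \<tau>) = 0" "Re (w' * \<tau>) = 0" using \<tau>(2) supp by blast+
  moreover have "cmod (w * \<tau>) = cmod (w' * \<tau>)" using norm_eq by (simp add: norm_mult)
  ultimately have "\<bar>Im (w * \<tau>)\<bar> = \<bar>Im (w' * \<tau>)\<bar>" by (simp add: cmod_def del: times_complex.sel)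
  hence "w * \<tau> = w' * \<tau> \<or> w * \<tau> = - w' * \<tau>"
    using Re_0 by (auto simp: complex_eq_iff abs_eq_iff simp del: times_complex.sel)
  hence "w = w' \<or> w = - w'" using \<tau>(1) by (metis mult_cancel_right)
  moreover have "w = w'" if opposite: "w = - w'"
  proof (rule ccontr)
    assume "w \<noteq> w'"
    hence "cnj w' \<noteq> 0" using opposite by auto
    have "Re (w' * v) = Re (w' * z)" if "v \<in> S" for v
      using supp[OF that] unfolding opposite by simp
    hence "S \<subseteq> {v. inner (cnj w') v = Re (w' * z)}" by (auto simp: inner_complex_def)
    hence "interior S \<subseteq> {}"
      using interior_mono interior_hyperplane[OF \<open>cnj w' \<noteq> 0\<close>] by metis
    thus False using S(2) by simp
  qed
  ultimately show ?thesis by blast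
qed

section \<open>Orthonormal families and Hermitian matrices\<close>

lemma mat_adjoint_carrier:
  assumes "A \<in> carrier_mat n m"
  shows "mat_adjoint A \<in> carrier_mat m n"
  using assms unfolding mat_adjoint_def by (auto simp: mat_of_rows_def)

lemma mat_adjoint_index:
  assumes "A \<in> carrier_mat n m" "i < m" "j < n"
  shows "mat_adjoint A $$ (i, j) = conjugate (A $$ (j, i))"
  using assms unfolding mat_adjoint_def by (auto simp: mat_of_rows_def)

lemma conjugate_mult_mat_vec_scalar_prod:
  assumes A: "A \<in> carrier_mat n m" and x: "x \<in> carrier_vec m" and y: "y \<in> carrier_vec n"
  shows "conjugate (A *\<^sub>v x) \<bullet> y = conjugate x \<bullet> (mat_adjoint A *\<^sub>v y)"
proof -
  have "conjugate (A *\<^sub>v x) \<bullet> y = (\<Sum>i<n. \<Sum>j<m. conjugate (A $$ (i, j)) * conjugate (x $ j) * y $ i)"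
    using assms
    by (auto simp: scalar_prod_def atLeast0LessThan sum_conjugate conjugate_dist_mul
        sum_distrib_right intro!: sum.cong)
  also have "\<dots> = (\<Sum>j<m. \<Sum>i<n. conjugate (A $$ (i, j)) * conjugate (x $ j) * y $ i)"
    by (rule sum.swap)
  also have "\<dots> = conjugate x \<bullet> (mat_adjoint A *\<^sub>v y)"
    using assms mat_adjoint_carrier[OF A]
    by (auto simp: scalar_prod_def atLeast0LessThan mat_adjoint_index[OF A] sum_distrib_left mult_ac
        intro!: sum.cong)
  finally show ?thesis .
qed

definition orthonormal_family :: "nat \<Rightarrow> (nat \<Rightarrow> complex vec) \<Rightarrow> bool" where
  "orthonormal_family n x \<longleftrightarrow> (\<forall>j<n. x j \<in> carrier_vec n) \<and>
     (\<forall>j<n. \<forall>k<n. conjugate (x j) \<bullet> x k = (if j = k then 1 else 0))"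

lemma orthonormal_familyD:
  assumes "orthonormal_family n x" "j < n"
  shows "x j \<in> carrier_vec n" "k < n \<Longrightarrow> conjugate (x j) \<bullet> x k = (if j = k then 1 else 0)"
  using assms unfolding orthonormal_family_def by blast+

lemma orthonormal_family_normalize:
  fixes us :: "complex vec list"
  assumes us: "set us \<subseteq> carrier_vec n" "corthogonal us" "length us = n"
  shows "orthonormal_family n (\<lambda>i. of_real (1 / sqrt (Re (us ! i \<bullet>c us ! i))) \<cdot>\<^sub>v us ! i)"
proof -
  have carrier: "us ! i \<in> carrier_vec n" if "i < n" for i using us(1,3) that by auto
  define l where "l i = Re (us ! i \<bullet>c us ! i)" for i
  define w where "w i = complex_of_real (1 / sqrt (l i)) \<cdot>\<^sub>v us ! i" for i
  have norm: "us ! i \<bullet>c us ! i = of_real (l i)" "l i > 0" if "i < n" for i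
  proof -
    have "us ! i \<bullet>c us ! i \<noteq> 0" using corthogonalD[OF us(2)] us(3) that by simp
    hence "us ! i \<bullet>c us ! i > 0" using conjugate_square_ge_0_vec[of "us ! i"] by (simp add: less_le)
    thus "us ! i \<bullet>c us ! i = of_real (l i)" "l i > 0"
      by (auto simp: l_def less_complex_def complex_eq_iff)
  qed
  have "conjugate (w i) \<bullet> w j = (if i = j then 1 else 0)" if "i < n" "j < n" for i j
  proof -
    have "conjugate (w i) \<bullet> w j =
        of_real (1 / sqrt (l i)) * of_real (1 / sqrt (l j)) * (us ! j \<bullet>c us ! i)"
      using carrier[OF that(1)] carrier[OF that(2)]
      by (simp add: w_def conjugate_smult_vec conjugate_vec_sprod_comm[of _ n]
          smult_scalar_prod_distrib[of _ n] scalar_prod_smult_distrib[of _ n])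
    also have "\<dots> = (if i = j then 1 else 0)"
    proof (cases "i = j")
      case True
      have "sqrt (l j) * sqrt (l j) = l j" using norm(2)[OF that(2)] by simp
      thus ?thesis using True norm[OF that(2)] by (simp flip: of_real_mult)
    next
      case False
      thus ?thesis using corthogonalD[OF us(2), of j i] us(3) that by simp
    qed
    finally show ?thesis .
  qed
  hence "orthonormal_family n w" using carrier by (simp add: orthonormal_family_def w_def)
  thus ?thesis unfolding w_def l_def .
qed

lemma ex_orthonormal_family_starting_with:
  fixes v :: "complex vec"
  assumes v: "v \<in> carrier_vec n" "v \<noteq> 0\<^sub>v n" and n: "n > 0"
  obtains w s where "orthonormal_family n w" "w 0 = s \<cdot>\<^sub>v v"
proof -
  interpret cof_vec_space n "TYPE(complex)" .
  note basis = basis_completion[OF v]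
  define us where "us = gram_schmidt n (basis_completion v)"
  have us: "set us \<subseteq> carrier_vec n" "corthogonal us" "length us = n"
    using gram_schmidt_result[OF basis(2,4,5) us_def] basis(6) by auto
  have "basis_completion v = v # tl (basis_completion v)"
    using basis(6,7) n by (cases "basis_completion v") auto
  hence "us ! 0 = v"
    using gram_schmidt_hd[OF v(1)] us(3) n unfolding us_def
    by (metis hd_conv_nth length_greater_0_conv)
  thus ?thesis using that[OF orthonormal_family_normalize[OF us]] by simp
qed

lemma mat_of_cols_orthonormal:
  assumes "orthonormal_family n w"
  defines "W \<equiv> mat_of_cols n (map w [0..<n])"
  shows "W \<in> carrier_mat n n" "mat_adjoint W * W = 1\<^sub>m n" "\<And>j. j < n \<Longrightarrow> col W j = w j"
proof -
  show W: "W \<in> carrier_mat n n" using mat_of_cols_carrier(1)[of n "map w [0..<n]"]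
    by (simp add: W_def)
  show col: "col W j = w j" if "j < n" for j
    using that orthonormal_familyD(1)[OF assms(1)] by (simp add: W_def)
  have "row (mat_adjoint W) i = conjugate (w i)" if "i < n" for i
    unfolding col[OF that, symmetric]
    by (rule eq_vecI) (use that W mat_adjoint_carrier[OF W] in \<open>auto simp: mat_adjoint_index[OF W]\<close>)
  thus "mat_adjoint W * W = 1\<^sub>m n"
    by (intro eq_matI)
      (use W mat_adjoint_carrier[OF W] orthonormal_familyD(2)[OF assms(1)] col in auto)
qed

lemma ex_unitary_deflation:
  fixes A :: "complex mat"
  assumes A: "A \<in> carrier_mat (Suc m) (Suc m)" and "eigenvalue A e"
  obtains W u B where "W \<in> carrier_mat (Suc m) (Suc m)" "mat_adjoint W * W = 1\<^sub>m (Suc m)"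
    "u \<in> carrier_mat 1 m" "B \<in> carrier_mat m m"
    "mat_adjoint W * A * W = four_block_mat (Matrix.mat 1 1 (\<lambda>_. e)) u (0\<^sub>m m 1) B"
proof -
  let ?n = "Suc m"
  obtain v where v: "v \<in> carrier_vec ?n" "v \<noteq> 0\<^sub>v ?n" "A *\<^sub>v v = e \<cdot>\<^sub>v v"
    using assms unfolding eigenvalue_def eigenvector_def by auto
  obtain w s where w: "orthonormal_family ?n w" "w 0 = s \<cdot>\<^sub>v v"
    using ex_orthonormal_family_starting_with[OF v(1,2)] by blast
  define W where "W = mat_of_cols ?n (map w [0..<?n])"
  note W = mat_of_cols_orthonormal[OF w(1), folded W_def]
  note W_adjoint = mat_adjoint_carrier[OF W(1)]
  define T where "T = mat_adjoint W * A * W"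
  have T: "T \<in> carrier_mat ?n ?n" using A W(1) W_adjoint by (simp add: T_def)
  have "col (A * W) 0 = A *\<^sub>v col W 0" using A W(1) by (intro col_mult2) auto
  also have "\<dots> = e \<cdot>\<^sub>v col W 0"
    unfolding W(3)[OF zero_less_Suc] w(2) using v A
    by (simp add: mult_mat_vec smult_smult_assoc mult.commute)
  finally have col_0: "col (A * W) 0 = e \<cdot>\<^sub>v col W 0" .
  have "T $$ (i, 0) = (if i = 0 then e else 0)" if "i < ?n" for i
  proof -
    have "T $$ (i, 0) = row (mat_adjoint W) i \<bullet> col (A * W) 0"
      using that A W(1) W_adjoint by (simp add: T_def assoc_mult_mat[of _ ?n ?n _ ?n _ ?n])
    also have "\<dots> = e * (mat_adjoint W * W) $$ (i, 0)"
      using that W(1) W_adjoint by (simp add: col_0)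
    finally show ?thesis unfolding W(2) using that by simp
  qed
  hence "T = four_block_mat (Matrix.mat 1 1 (\<lambda>_. e)) (Matrix.mat 1 m (\<lambda>(i, j). T $$ (0, Suc j)))
      (0\<^sub>m m 1) (Matrix.mat m m (\<lambda>(i, j). T $$ (Suc i, Suc j)))"
    by (intro eq_matI) (use T in \<open>auto simp: less_Suc_eq_0_disj\<close>)
  thus ?thesis by (intro that[OF W(1,2) mat_carrier mat_carrier]) (simp add: T_def)
qed

lemma char_poly_unitary_conjugate:
  fixes A :: "complex mat"
  assumes A: "A \<in> carrier_mat n n" and W: "W \<in> carrier_mat n n" "mat_adjoint W * W = 1\<^sub>m n"
  shows "char_poly (mat_adjoint W * A * W) = char_poly A"
proof -
  note W_adjoint = mat_adjoint_carrier[OF W(1)]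
  have "W * mat_adjoint W = 1\<^sub>m n" by (rule mat_mult_left_right_inverse[OF W_adjoint W])
  hence "similar_mat_wit (mat_adjoint W * A * W) A (mat_adjoint W) W"
    by (intro similar_mat_witI[of _ _ n]) (use W W_adjoint A in auto)
  thus ?thesis using char_poly_similar unfolding similar_mat_def by blast
qed

lemma quadratic_form_conjugate:
  assumes A: "A \<in> carrier_mat n n" and W: "W \<in> carrier_mat n m" and z: "z \<in> carrier_vec m"
  shows "conjugate (W *\<^sub>v z) \<bullet> (A *\<^sub>v (W *\<^sub>v z)) = conjugate z \<bullet> ((mat_adjoint W * A * W) *\<^sub>v z)"
proof -
  note W_adjoint = mat_adjoint_carrier[OF W]
  have "conjugate (W *\<^sub>v z) \<bullet> (A *\<^sub>v (W *\<^sub>v z)) =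
      conjugate z \<bullet> (mat_adjoint W *\<^sub>v (A *\<^sub>v (W *\<^sub>v z)))"
    using A W z by (intro conjugate_mult_mat_vec_scalar_prod) auto
  also have "mat_adjoint W *\<^sub>v (A *\<^sub>v (W *\<^sub>v z)) = (mat_adjoint W * A) *\<^sub>v (W *\<^sub>v z)"
    using A W W_adjoint z by (intro assoc_mult_mat_vec[symmetric]) auto
  also have "\<dots> = (mat_adjoint W * A * W) *\<^sub>v z"
    using A W W_adjoint z by (intro assoc_mult_mat_vec[symmetric]) auto
  finally show ?thesis .
qed

lemma orthonormal_family_unitary_image:
  assumes W: "W \<in> carrier_mat n n" "mat_adjoint W * W = 1\<^sub>m n" and z: "orthonormal_family n z"
  shows "orthonormal_family n (\<lambda>j. W *\<^sub>v z j)"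
proof -
  have "conjugate (W *\<^sub>v z j) \<bullet> (W *\<^sub>v z k) = conjugate (z j) \<bullet> z k" if "j < n" "k < n" for j k
  proof -
    note carrier = orthonormal_familyD(1)[OF z that(1)] orthonormal_familyD(1)[OF z that(2)]
    have "conjugate (W *\<^sub>v z j) \<bullet> (W *\<^sub>v z k) = conjugate (z j) \<bullet> (mat_adjoint W *\<^sub>v (W *\<^sub>v z k))"
      using W(1) carrier by (intro conjugate_mult_mat_vec_scalar_prod) auto
    also have "mat_adjoint W *\<^sub>v (W *\<^sub>v z k) = z k"
      using W carrier mat_adjoint_carrier[OF W(1)] by (metis assoc_mult_mat_vec one_mult_mat_vec)
    finally show ?thesis .
  qed
  thus ?thesis using z W(1) by (auto simp: orthonormal_family_def)
qed

definition bordered_family :: "nat \<Rightarrow> (nat \<Rightarrow> complex vec) \<Rightarrow> nat \<Rightarrow> complex vec" where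
  "bordered_family m y j = (case j of 0 \<Rightarrow> unit_vec 1 0 @\<^sub>v 0\<^sub>v m | Suc i \<Rightarrow> 0\<^sub>v 1 @\<^sub>v y i)"

lemma bordered_family_simps:
  "bordered_family m y 0 = unit_vec 1 0 @\<^sub>v 0\<^sub>v m" "bordered_family m y (Suc j) = 0\<^sub>v 1 @\<^sub>v y j"
  by (simp_all add: bordered_family_def)

lemma conjugate_append_vec: "conjugate (v @\<^sub>v w) = conjugate v @\<^sub>v conjugate w"
  by (rule eq_vecI) auto

lemma
  assumes a: "a \<in> carrier_vec 1" and b: "b \<in> carrier_vec m"
  shows bordered_family_0_scalar_prod: "conjugate (bordered_family m y 0) \<bullet> (a @\<^sub>v b) = a $ 0"
    and bordered_family_Suc_scalar_prod: "y j \<in> carrier_vec m \<Longrightarrow>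
      conjugate (bordered_family m y (Suc j)) \<bullet> (a @\<^sub>v b) = conjugate (y j) \<bullet> b"
proof -
  have "conjugate (unit_vec (Suc 0) 0) = (unit_vec (Suc 0) 0 :: complex vec)" by (rule eq_vecI) auto
  thus "conjugate (bordered_family m y 0) \<bullet> (a @\<^sub>v b) = a $ 0"
    using a b scalar_prod_append[of "unit_vec 1 0" 1 "0\<^sub>v m" m a b]
    by (simp add: bordered_family_def conjugate_append_vec)
  assume "y j \<in> carrier_vec m"
  thus "conjugate (bordered_family m y (Suc j)) \<bullet> (a @\<^sub>v b) = conjugate (y j) \<bullet> b"
    using a b scalar_prod_append[of "0\<^sub>v 1" 1 "conjugate (y j)" m a b]
    by (simp add: bordered_family_def conjugate_append_vec)
qed

lemma orthonormal_bordered_family: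
  assumes y: "orthonormal_family m y"
  shows "orthonormal_family (Suc m) (bordered_family m y)"
proof -
  let ?z = "bordered_family m y"
  note y_carrier = orthonormal_familyD(1)[OF y]
  note dot_0 = bordered_family_0_scalar_prod and dot_Suc = bordered_family_Suc_scalar_prod
  note z_0 = bordered_family_simps(1)[of m y] and z_Suc = bordered_family_simps(2)[of m y]
  have "conjugate (?z 0) \<bullet> ?z 0 = 1" by (subst (2) z_0) (simp add: dot_0)
  moreover have "conjugate (?z 0) \<bullet> ?z (Suc k) = 0" if "k < m" for k
    unfolding z_Suc using y_carrier[OF that] by (simp add: dot_0)
  moreover have "conjugate (?z (Suc j)) \<bullet> ?z 0 = 0" if "j < m" for j
    unfolding z_0 using y_carrier[OF that] by (simp add: dot_Suc)
  moreover have "conjugate (?z (Suc j)) \<bullet> ?z (Suc k) = (if j = k then 1 else 0)" if "j < m" "k < m"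
    for j k
    unfolding z_Suc[of k]
    using y_carrier[OF that(1)] y_carrier[OF that(2)] orthonormal_familyD(2)[OF y that]
    by (simp add: dot_Suc)
  moreover have "?z 0 \<in> carrier_vec (Suc m)"
    using append_carrier_vec[of "unit_vec 1 0" 1 "0\<^sub>v m" m] unfolding z_0 by simp
  moreover have "?z (Suc j) \<in> carrier_vec (Suc m)" if "j < m" for j
    using append_carrier_vec[OF zero_carrier_vec y_carrier[OF that], of 1] unfolding z_Suc by simp
  ultimately show ?thesis by (simp add: orthonormal_family_def All_less_Suc2)
qed

lemma
  fixes e :: complex
  assumes u: "u \<in> carrier_mat 1 m" and B: "B \<in> carrier_mat m m"
  defines "T \<equiv> four_block_mat (Matrix.mat 1 1 (\<lambda>_. e)) u (0\<^sub>m m 1) B"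
  shows quadratic_form_bordered_family_0:
      "conjugate (bordered_family m y 0) \<bullet> (T *\<^sub>v bordered_family m y 0) = e"
    and quadratic_form_bordered_family_Suc: "y j \<in> carrier_vec m \<Longrightarrow>
      conjugate (bordered_family m y (Suc j)) \<bullet> (T *\<^sub>v bordered_family m y (Suc j)) =
        conjugate (y j) \<bullet> (B *\<^sub>v y j)"
proof -
  let ?E = "Matrix.mat 1 1 (\<lambda>_. e)"
  have E: "?E \<in> carrier_mat 1 1" by simp
  note T_mult = four_block_mat_mult_vec[OF E u zero_carrier_mat B, folded T_def]
  have "?E *\<^sub>v unit_vec 1 0 + u *\<^sub>v 0\<^sub>v m = vec 1 (\<lambda>_. e)"
    by (rule eq_vecI) (use u in auto)
  moreover have "0\<^sub>m m 1 *\<^sub>v unit_vec 1 0 + B *\<^sub>v 0\<^sub>v m = 0\<^sub>v m"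
    by (rule eq_vecI) (use B in auto)
  ultimately have "T *\<^sub>v bordered_family m y 0 = vec 1 (\<lambda>_. e) @\<^sub>v 0\<^sub>v m"
    unfolding bordered_family_simps by (subst T_mult) auto
  thus "conjugate (bordered_family m y 0) \<bullet> (T *\<^sub>v bordered_family m y 0) = e"
    by (simp add: bordered_family_0_scalar_prod)
  assume y: "y j \<in> carrier_vec m"
  have "?E *\<^sub>v 0\<^sub>v 1 + u *\<^sub>v y j = u *\<^sub>v y j"
    by (rule eq_vecI) (use u in auto)
  moreover have "0\<^sub>m m 1 *\<^sub>v 0\<^sub>v 1 + B *\<^sub>v y j = B *\<^sub>v y j"
    by (rule eq_vecI) (use B in auto)
  ultimately have "T *\<^sub>v bordered_family m y (Suc j) = (u *\<^sub>v y j) @\<^sub>v (B *\<^sub>v y j)"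
    unfolding bordered_family_simps using y by (subst T_mult) auto
  thus "conjugate (bordered_family m y (Suc j)) \<bullet> (T *\<^sub>v bordered_family m y (Suc j)) =
      conjugate (y j) \<bullet> (B *\<^sub>v y j)"
    using u B y by (simp add: bordered_family_Suc_scalar_prod)
qed

lemma char_poly_four_block_mat_1:
  fixes B :: "'a :: idom mat"
  assumes u: "u \<in> carrier_mat 1 m" and B: "B \<in> carrier_mat m m"
  shows "char_poly (four_block_mat (Matrix.mat 1 1 (\<lambda>_. e)) u (0\<^sub>m m 1) B) =
    [:- e, 1:] * char_poly B"
proof -
  have "char_poly (Matrix.mat 1 1 (\<lambda>_. e)) = [:- e, 1:]"
    by (simp add: char_poly_defs det_def sign_def)
  thus ?thesis by (subst char_poly_four_block_zeros_col[OF _ u B]) simp_all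
qed

lemma ex_orthonormal_family_of_deflation:
  assumes A: "A \<in> carrier_mat (Suc m) (Suc m)"
    and W: "W \<in> carrier_mat (Suc m) (Suc m)" "mat_adjoint W * W = 1\<^sub>m (Suc m)"
    and u: "u \<in> carrier_mat 1 m" and B: "B \<in> carrier_mat m m"
    and T: "mat_adjoint W * A * W = four_block_mat (Matrix.mat 1 1 (\<lambda>_. e)) u (0\<^sub>m m 1) B"
    and y: "orthonormal_family m y" "\<And>j. j < m \<Longrightarrow> conjugate (y j) \<bullet> (B *\<^sub>v y j) = es ! j"
  shows "\<exists>x. orthonormal_family (Suc m) x \<and>
    (\<forall>j<Suc m. conjugate (x j) \<bullet> (A *\<^sub>v x j) = (e # es) ! j)"
proof -
  let ?z = "bordered_family m y" and ?T = "four_block_mat (Matrix.mat 1 1 (\<lambda>_. e)) u (0\<^sub>m m 1) B"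
  note z = orthonormal_bordered_family[OF y(1)]
  have "conjugate (W *\<^sub>v ?z j) \<bullet> (A *\<^sub>v (W *\<^sub>v ?z j)) = (e # es) ! j" if "j < Suc m" for j
    unfolding quadratic_form_conjugate[OF A W(1) orthonormal_familyD(1)[OF z that]] T
  proof (cases j)
    case 0
    thus "conjugate (?z j) \<bullet> (?T *\<^sub>v ?z j) = (e # es) ! j"
      using quadratic_form_bordered_family_0[OF u B] by simp
  next
    case (Suc i)
    hence "i < m" using that by simp
    thus "conjugate (?z j) \<bullet> (?T *\<^sub>v ?z j) = (e # es) ! j"
      using Suc y(2) quadratic_form_bordered_family_Suc[OF u B orthonormal_familyD(1)[OF y(1)]]
      by simp
  qed
  thus ?thesis using orthonormal_family_unitary_image[OF W z] by blast
qed

theorem ex_orthonormal_family_diagonal: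
  fixes A :: "complex mat"
  assumes "A \<in> carrier_mat n n" "char_poly A = (\<Prod>e\<leftarrow>es. [:- e, 1:])"
  shows "\<exists>x. orthonormal_family n x \<and> (\<forall>j<n. conjugate (x j) \<bullet> (A *\<^sub>v x j) = es ! j)"
  using assms
proof (induction es arbitrary: n A)
  case Nil
  hence "n = 0" using degree_monic_char_poly[of A n] by simp
  thus ?case by (simp add: orthonormal_family_def)
next
  case (Cons e es)
  have "n = length (e # es)"
    using degree_monic_char_poly[OF Cons.prems(1)] degree_linear_factors[of uminus "e # es"]
    by (simp add: Cons.prems(2))
  then obtain m where n: "n = Suc m" by simp
  note A = Cons.prems(1)[unfolded n]
  have "eigenvalue A e" unfolding eigenvalue_root_char_poly[OF A] Cons.prems(2) by simp
  then obtain W u B where W: "W \<in> carrier_mat (Suc m) (Suc m)" "mat_adjoint W * W = 1\<^sub>m (Suc m)"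
    and u: "u \<in> carrier_mat 1 m" and B: "B \<in> carrier_mat m m"
    and T: "mat_adjoint W * A * W = four_block_mat (Matrix.mat 1 1 (\<lambda>_. e)) u (0\<^sub>m m 1) B"
    using ex_unitary_deflation[OF A] by blast
  have "[:- e, 1:] * char_poly B = [:- e, 1:] * (\<Prod>e\<leftarrow>es. [:- e, 1:])"
    using char_poly_unitary_conjugate[OF A W] Cons.prems(2)
    unfolding T char_poly_four_block_mat_1[OF u B] by simp
  hence "char_poly B = (\<Prod>e\<leftarrow>es. [:- e, 1:])"
    by (metis mult_cancel_left pCons_eq_0_iff zero_neq_one)
  then obtain y where y: "orthonormal_family m y"
      "\<And>j. j < m \<Longrightarrow> conjugate (y j) \<bullet> (B *\<^sub>v y j) = es ! j"
    using Cons.IH[OF B] by blast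
  show ?case unfolding n
    by (rule ex_orthonormal_family_of_deflation[OF A W u B T]) (use y in auto)
qed

lemma char_poly_eq_prod_eig_mset:
  assumes "M \<in> carrier_mat n n"
  shows "char_poly M = (\<Prod>a\<in>#eig_mset M. [:- a, 1:])"
  using complex_poly_decompose_multiset[of "char_poly M"] degree_monic_char_poly[OF assms]
  by (simp add: eig_mset_def)

lemma mset_eig_list: "mset (eig_list M) = eig_mset M"
  unfolding eig_list_def by (rule someI_ex) (rule ex_mset)

lemma length_eig_list:
  assumes "M \<in> carrier_mat n n"
  shows "length (eig_list M) = n"
  using degree_monic_char_poly[OF assms] size_proots_complex[of "char_poly M"]
  by (simp flip: size_mset add: mset_eig_list eig_mset_def)

lemma eig_mset_smult:
  assumes "M \<in> carrier_mat n n" and s: "s \<noteq> 0"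
  shows "eig_mset (s \<cdot>\<^sub>m M) = image_mset ((*) s) (eig_mset M)"
proof (rule multiset_eqI)
  fix a
  have nonzero: "char_poly (s \<cdot>\<^sub>m M) \<noteq> 0" "char_poly M \<noteq> 0"
    using degree_monic_char_poly[of "s \<cdot>\<^sub>m M" n] degree_monic_char_poly[of M n] assms(1) by auto
  have "{b. b \<in># eig_mset M \<and> a = s * b} = (if a / s \<in># eig_mset M then {a / s} else {})"
    using s by (auto simp: field_simps)
  hence "count (image_mset ((*) s) (eig_mset M)) a = count (eig_mset M) (a / s)"
    by (simp add: count_image_mset' not_in_iff)
  thus "count (eig_mset (s \<cdot>\<^sub>m M)) a = count (image_mset ((*) s) (eig_mset M)) a"
    using nonzero order_char_poly_smult[OF assms, of a] by (simp add: eig_mset_def)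
qed

lemma eigenvalue_Hermitian_real:
  fixes H :: "complex mat"
  assumes H: "H \<in> carrier_mat n n" "mat_adjoint H = H" and "eigenvalue H e"
  shows "Im e = 0"
proof -
  obtain v where v: "v \<in> carrier_vec n" "v \<noteq> 0\<^sub>v n" "H *\<^sub>v v = e \<cdot>\<^sub>v v"
    using assms unfolding eigenvalue_def eigenvector_def by auto
  have "conjugate (H *\<^sub>v v) \<bullet> v = conjugate v \<bullet> (H *\<^sub>v v)"
    using conjugate_mult_mat_vec_scalar_prod[OF H(1) v(1,1)] by (simp add: H(2))
  hence "cnj e * (conjugate v \<bullet> v) = e * (conjugate v \<bullet> v)"
    using v(1) unfolding v(3)
    by (simp add: conjugate_smult_vec smult_scalar_prod_distrib[of _ n]
        scalar_prod_smult_distrib[of _ n])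
  moreover have "conjugate v \<bullet> v \<noteq> 0"
    using v(1,2) by (simp flip: conjugate_vec_sprod_comm)
  ultimately have "cnj e = e" by simp
  thus ?thesis by (simp add: complex_eq_iff)
qed

lemma mset_herm_eig:
  assumes H: "H \<in> carrier_mat n n" "mat_adjoint H = H"
  shows "mset (map of_real (herm_eig H)) = eig_mset H"
proof -
  have "of_real (Re a) = a" if "a \<in># eig_mset H" for a
  proof -
    have "eigenvalue H a"
      using that H(1) degree_monic_char_poly[OF H(1)] unfolding eig_mset_def
      by (cases "char_poly H = 0") (auto simp: eigenvalue_root_char_poly)
    thus ?thesis using eigenvalue_Hermitian_real[OF H] by (simp add: complex_eq_iff)
  qed
  hence "image_mset (\<lambda>a. of_real (Re a)) (eig_mset H) = image_mset (\<lambda>a. a) (eig_mset H)"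
    by (intro image_mset_cong)
  moreover have "mset (herm_eig H) = image_mset Re (eig_mset H)" by (simp add: herm_eig_def)
  ultimately show ?thesis by (simp add: image_mset.compositionality comp_def)
qed

lemma length_herm_eig:
  assumes "H \<in> carrier_mat n n"
  shows "length (herm_eig H) = n"
proof -
  have "length (herm_eig H) = size (eig_mset H)"
    by (simp add: herm_eig_def flip: size_mset)
  thus ?thesis
    using degree_monic_char_poly[OF assms] by (simp add: eig_mset_def size_proots_complex)
qed

lemma ex_orthonormal_family_herm_eig:
  assumes H: "H \<in> carrier_mat n n" "mat_adjoint H = H"
  obtains x where "orthonormal_family n x"
    "\<And>j. j < n \<Longrightarrow> conjugate (x j) \<bullet> (H *\<^sub>v x j) = of_real (herm_eig H ! j)"
proof -
  have "char_poly H = (\<Prod>a\<leftarrow>map of_real (herm_eig H). [:- a, 1:])"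
    unfolding char_poly_eq_prod_eig_mset[OF H(1)] mset_herm_eig[OF H, symmetric]
    by (metis mset_map prod_mset_prod_list)
  thus ?thesis
    using ex_orthonormal_family_diagonal[OF H(1)] that length_herm_eig[OF H(1)] by (metis nth_map)
qed

section \<open>Values of linear forms in eigenvalues\<close>

lemma ex_permutation_extending:
  assumes "finite I" "S \<subseteq> I" "\<sigma> ` S \<subseteq> I" "inj_on \<sigma> S"
  obtains \<pi> where "\<pi> permutes I" "\<And>s. s \<in> S \<Longrightarrow> \<sigma> s = \<pi> s"
proof -
  have "finite S" using assms(1,2) by (rule rev_finite_subset)
  hence "card (I - S) = card (I - \<sigma> ` S)"
    by (simp add: card_Diff_subset assms(2,3) card_image[OF assms(4)])
  then obtain \<rho> where \<rho>: "bij_betw \<rho> (I - S) (I - \<sigma> ` S)"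
    using finite_same_card_bij[OF finite_Diff finite_Diff] assms(1) by metis
  define \<pi> where "\<pi> i = (if i \<in> S then \<sigma> i else if i \<in> I then \<rho> i else i)" for i
  have "bij_betw \<pi> S (\<sigma> ` S)"
    using inj_on_imp_bij_betw[OF assms(4)]
    by (rule bij_betw_cong[THEN iffD1, rotated]) (simp add: \<pi>_def)
  moreover have "bij_betw \<pi> (I - S) (I - \<sigma> ` S)"
    using \<rho> by (rule bij_betw_cong[THEN iffD1, rotated]) (simp add: \<pi>_def)
  ultimately have "bij_betw \<pi> (S \<union> (I - S)) (\<sigma> ` S \<union> (I - \<sigma> ` S))"
    by (rule bij_betw_combine) blast
  hence "bij_betw \<pi> I I"
    by (simp only: Un_Diff_cancel Un_absorb1[OF assms(2)] Un_absorb1[OF assms(3)])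
  moreover have "\<pi> i = i" if "i \<notin> I" for i using assms(2) that by (auto simp: \<pi>_def)
  ultimately have "\<pi> permutes I" by (rule bij_imp_permutes)
  thus ?thesis using that by (simp add: \<pi>_def)
qed

text \<open>The coefficients of a linear form vanish beyond \<open>n\<close>, whereas \<open>c\<close> is arbitrary there.\<close>
definition cutoff :: "nat \<Rightarrow> (nat \<Rightarrow> real) \<Rightarrow> nat \<Rightarrow> real" where
  "cutoff n c k = (if k < n then c k else 0)"

lemma sum_cutoff_comp_permutation:
  fixes h :: "nat \<Rightarrow> 'a :: real_algebra_1"
  assumes "\<pi> permutes {..<n}"
  shows "(\<Sum>k<n. of_real ((cutoff n c \<circ> inv \<pi>) k) * h k) = (\<Sum>k<n. of_real (c k) * h (\<pi> k))"
proof -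
  have "(\<Sum>k<n. of_real ((cutoff n c \<circ> inv \<pi>) k) * h k) =
      (\<Sum>k<n. of_real (cutoff n c (inv \<pi> (\<pi> k))) * h (\<pi> k))"
    by (subst sum.permute[OF assms]) (simp add: comp_def)
  thus ?thesis by (simp add: permutes_inverses(2)[OF assms] cutoff_def)
qed

lemma supp_c_subset: "supp_c n c \<subseteq> {..<n}"
  by (auto simp: supp_c_def)

lemma permutes_imp_index_tuple:
  assumes "\<pi> permutes {..<n}"
  shows "index_tuple n c \<pi>"
  using permutes_inj_on[OF assms] permutes_image[OF assms] supp_c_subset[of n c]
  unfolding index_tuple_def by blast

lemma index_tuple_eq_permutation:
  assumes "index_tuple n c \<sigma>"
  obtains \<pi> where "\<pi> permutes {..<n}" "\<And>s. s \<in> supp_c n c \<Longrightarrow> \<sigma> s = \<pi> s"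
  using ex_permutation_extending[OF finite_lessThan supp_c_subset] assms
  unfolding index_tuple_def by blast

lemma lin_form_permutation:
  assumes \<pi>: "\<pi> permutes {..<n}" and agree: "\<And>s. s \<in> supp_c n c \<Longrightarrow> \<sigma> s = \<pi> s"
  shows "lin_form n c \<sigma> = cutoff n c \<circ> inv \<pi>"
proof
  fix k
  have "\<sigma> s = k \<longleftrightarrow> s = inv \<pi> k" if "s \<in> supp_c n c" for s
    using agree[OF that] permutes_inv_eq[OF \<pi>, of k s] by auto
  hence "{s \<in> supp_c n c. \<sigma> s = k} = (if inv \<pi> k \<in> supp_c n c then {inv \<pi> k} else {})" by auto
  thus "lin_form n c \<sigma> k = (cutoff n c \<circ> inv \<pi>) k"
    by (simp add: lin_form_def cutoff_def supp_c_def)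
qed

lemma forms_eq_orbit: "forms n c = (\<lambda>\<pi>. cutoff n c \<circ> \<pi>) ` {\<pi>. \<pi> permutes {..<n}}"
proof -
  have "forms n c = (\<lambda>\<pi>. cutoff n c \<circ> inv \<pi>) ` {\<pi>. \<pi> permutes {..<n}}"
  proof (intro equalityI subsetI)
    fix f assume "f \<in> forms n c"
    then obtain \<sigma> where \<sigma>: "index_tuple n c \<sigma>" "f = lin_form n c \<sigma>" by (auto simp: forms_def)
    obtain \<pi> where \<pi>: "\<pi> permutes {..<n}" "\<And>s. s \<in> supp_c n c \<Longrightarrow> \<sigma> s = \<pi> s"
      using index_tuple_eq_permutation[OF \<sigma>(1)] by blast
    have "f = cutoff n c \<circ> inv \<pi>" unfolding \<sigma>(2) using \<pi> by (rule lin_form_permutation)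
    thus "f \<in> (\<lambda>\<pi>. cutoff n c \<circ> inv \<pi>) ` {\<pi>. \<pi> permutes {..<n}}" using \<pi>(1) by blast
  next
    fix f assume "f \<in> (\<lambda>\<pi>. cutoff n c \<circ> inv \<pi>) ` {\<pi>. \<pi> permutes {..<n}}"
    then obtain \<pi> where \<pi>: "\<pi> permutes {..<n}" "f = cutoff n c \<circ> inv \<pi>" by blast
    hence "f = lin_form n c \<pi>" using lin_form_permutation[OF \<pi>(1) refl] by simp
    thus "f \<in> forms n c" unfolding forms_def using permutes_imp_index_tuple[OF \<pi>(1)] by blast
  qed
  also have "\<dots> = (\<lambda>\<pi>. cutoff n c \<circ> \<pi>) ` {inv \<pi> |\<pi>. \<pi> permutes {..<n}}" by blast
  finally show ?thesis unfolding image_inverse_permutations .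
qed

lemma finite_forms [simp]: "finite (forms n c)"
  unfolding forms_eq_orbit by (simp add: finite_permutations)

lemma forms_comp_permutation:
  assumes "\<pi> permutes {..<n}" "f \<in> forms n c"
  shows "f \<circ> \<pi> \<in> forms n c"
  using assms unfolding forms_eq_orbit by (auto simp: comp_assoc intro: permutes_compose)

lemma bij_betw_forms_comp_permutation:
  assumes \<pi>: "\<pi> permutes {..<n}"
  shows "bij_betw (\<lambda>f. f \<circ> \<pi>) (forms n c) (forms n c)"
  using forms_comp_permutation \<pi> permutes_inv[OF \<pi>] permutes_inv_o[OF \<pi>]
  by (intro bij_betwI[where g="\<lambda>f. f \<circ> inv \<pi>"]) (auto simp: comp_assoc)

text \<open>Every linear form is attained by the same number of permutations, since the fibres are the
  cosets of the stabilizer of \<open>c\<close>.\<close>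
lemma ex_sum_permutations_eq_sum_forms:
  "\<exists>K>0. \<forall>G :: (nat \<Rightarrow> real) \<Rightarrow> 'a :: comm_semiring_1.
     (\<Sum>\<pi> | \<pi> permutes {..<n}. G (cutoff n c \<circ> \<pi>)) = of_nat K * (\<Sum>f\<in>forms n c. G f)"
proof -
  let ?P = "{\<pi>. \<pi> permutes {..<n}}"
  define fibre where "fibre f = {\<pi> \<in> ?P. cutoff n c \<circ> \<pi> = f}" for f
  define K where "K = card (fibre (cutoff n c))"
  have finite_P: "finite ?P" by (simp add: finite_permutations)
  have "id \<in> fibre (cutoff n c)" by (auto simp: fibre_def intro: permutes_id)
  moreover have "finite (fibre f)" for f using finite_P by (simp add: fibre_def)
  ultimately have "K > 0" unfolding K_def card_gt_0_iff by blast
  moreover have card_fibre: "card (fibre f) = K" if "f \<in> forms n c" for f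
  proof -
    obtain \<pi> where \<pi>: "\<pi> permutes {..<n}" "f = cutoff n c \<circ> \<pi>" using \<open>f \<in> forms n c\<close>
        by (auto simp: forms_eq_orbit)
    have "bij_betw (\<lambda>\<rho>. \<rho> \<circ> \<pi>) (fibre (cutoff n c)) (fibre f)"
    proof (rule bij_betwI[where g="\<lambda>\<rho>. \<rho> \<circ> inv \<pi>"])
      show "(\<lambda>\<rho>. \<rho> \<circ> \<pi>) \<in> fibre (cutoff n c) \<rightarrow> fibre f"
        using \<pi> by (auto simp: fibre_def comp_assoc[symmetric] intro: permutes_compose)
      show "(\<lambda>\<rho>. \<rho> \<circ> inv \<pi>) \<in> fibre f \<rightarrow> fibre (cutoff n c)"
        using \<pi> permutes_inv[OF \<pi>(1)] permutes_inv_o(1)[OF \<pi>(1)]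
        by (auto simp: fibre_def comp_assoc intro: permutes_compose) (metis comp_assoc comp_id)
    qed (use permutes_inv_o[OF \<pi>(1)] in \<open>auto simp: comp_assoc\<close>)
    thus ?thesis unfolding K_def by (metis bij_betw_same_card)
  qed
  moreover have "(\<Sum>\<pi>\<in>?P. G (cutoff n c \<circ> \<pi>)) = of_nat K * (\<Sum>f\<in>forms n c. G f)"
    for G :: "(nat \<Rightarrow> real) \<Rightarrow> 'a"
  proof -
    have "(\<Sum>\<pi>\<in>?P. G (cutoff n c \<circ> \<pi>)) = (\<Sum>f\<in>forms n c. \<Sum>\<pi>\<in>fibre f. G (cutoff n c \<circ> \<pi>))"
      unfolding fibre_def using finite_P by (intro sum.group[symmetric]) (auto simp: forms_eq_orbit)
    also have "\<dots> = (\<Sum>f\<in>forms n c. \<Sum>\<pi>\<in>fibre f. G f)"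
      by (intro sum.cong refl) (simp add: fibre_def)
    also have "\<dots> = of_nat K * (\<Sum>f\<in>forms n c. G f)" by (simp add: card_fibre sum_distrib_left)
    finally show ?thesis .
  qed
  ultimately show ?thesis by blast
qed

lemma coeff_prod_forms:
  fixes R :: "('x \<Rightarrow> complex) set"
  assumes "function_algebra R" and sums: "\<And>q. (\<lambda>z. \<Sum>k<n. \<alpha> k z ^ q) \<in> R"
  shows "(\<lambda>z. coeff (\<Prod>f\<in>forms n c. [:- (\<Sum>k<n. of_real (f k) * \<alpha> k z), 1:]) l) \<in> R"
proof -
  interpret function_algebra R by fact
  define v where "v f z = (\<Sum>k<n. of_real (f k) * \<alpha> k z)" for f :: "nat \<Rightarrow> real" and z
  obtain K where K: "K > 0" "\<And>G :: (nat \<Rightarrow> real) \<Rightarrow> complex.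
      (\<Sum>\<pi> | \<pi> permutes {..<n}. G (cutoff n c \<circ> \<pi>)) = of_nat K * (\<Sum>f\<in>forms n c. G f)"
    using ex_sum_permutations_eq_sum_forms by metis
  have "(\<Sum>f\<in>forms n c. v f z ^ q) =
      1 / of_nat K * (\<Sum>\<pi> | \<pi> permutes {..<n}. (\<Sum>k<n. of_real (c k) * \<alpha> (\<pi> k) z) ^ q)" for z q
  proof -
    have "of_nat K * (\<Sum>f\<in>forms n c. v f z ^ q) =
        (\<Sum>\<pi> | \<pi> permutes {..<n}. v (cutoff n c \<circ> inv \<pi>) z ^ q)"
      unfolding K(2)[symmetric] by (rule sum_permutations_inverse)
    also have "\<dots> = (\<Sum>\<pi> | \<pi> permutes {..<n}. (\<Sum>k<n. of_real (c k) * \<alpha> (\<pi> k) z) ^ q)"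
      unfolding v_def
      by (intro sum.cong refl) (simp add: sum_cutoff_comp_permutation del: comp_apply)
    finally show ?thesis using K(1) by (simp add: field_simps)
  qed
  moreover have "(\<lambda>z. \<Sum>\<pi> | \<pi> permutes {..<n}. (\<Sum>k<n. of_real (c k) * \<alpha> (\<pi> k) z) ^ q) \<in> R" for q
    using sums by (intro symmetrized_linear_form_power) auto
  ultimately have "(\<lambda>z. \<Sum>f\<in>forms n c. v f z ^ q) \<in> R" for q
    using cmult[of _ "1 / of_nat K"] by simp
  hence "(\<lambda>z. coeff (\<Prod>f\<in>forms n c. [:1, - v f z:]) (deg_c n c - l)) \<in> R"
    unfolding deg_c_def by (intro coeffs_if_power_sums) (rule finite_forms)
  moreover have "coeff (\<Prod>f\<in>forms n c. [:- v f z, 1:]) l =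
      (if l \<le> deg_c n c then coeff (\<Prod>f\<in>forms n c. [:1, - v f z:]) (deg_c n c - l) else 0)" for z
  proof (cases "l \<le> deg_c n c")
    case True
    thus ?thesis by (simp add: coeff_prod_linear_reversed flip: deg_c_def)
  next
    case False
    hence "degree (\<Prod>f\<in>forms n c. [:- v f z, 1:]) < l"
      by (simp only: degree_prod_linear deg_c_def not_le)
    thus ?thesis using False by (simp only: coeff_eq_0 if_False)
  qed
  ultimately show ?thesis unfolding v_def[symmetric] by (cases "l \<le> deg_c n c") auto
qed

definition value_poly :: "nat \<Rightarrow> (nat \<Rightarrow> real) \<Rightarrow> complex list \<Rightarrow> complex poly" where
  "value_poly n c xs = (\<Prod>f\<in>forms n c. [:- (\<Sum>k<n. of_real (f k) * xs ! k), 1:])"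

lemma p_poly_eq_value_poly: "p_poly n M c = value_poly n c (eig_list M)"
  unfolding p_poly_def value_poly_def ..

lemma value_poly_permute_list:
  assumes \<pi>: "\<pi> permutes {..<n}" and "length xs = n"
  shows "value_poly n c (permute_list \<pi> xs) = value_poly n c xs"
proof -
  have "(\<Sum>k<n. of_real (f k) * xs ! k) = (\<Sum>k<n. of_real ((f \<circ> \<pi>) k) * permute_list \<pi> xs ! k)"
    for f :: "nat \<Rightarrow> real"
    using assms by (subst sum.permute[OF \<pi>]) (auto simp: permute_list_nth intro!: sum.cong)
  hence "value_poly n c xs =
      (\<Prod>f\<in>forms n c. [:- (\<Sum>k<n. of_real ((f \<circ> \<pi>) k) * permute_list \<pi> xs ! k), 1:])"
    by (simp add: value_poly_def)
  also have "\<dots> = value_poly n c (permute_list \<pi> xs)"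
    unfolding value_poly_def
    by (rule prod.reindex_bij_betw[OF bij_betw_forms_comp_permutation[OF \<pi>]])
  finally show ?thesis ..
qed

lemma value_poly_cong_mset:
  assumes "mset xs = mset ys" "length ys = n"
  shows "value_poly n c xs = value_poly n c ys"
proof -
  obtain \<pi> where "\<pi> permutes {..<length ys}" "permute_list \<pi> ys = xs"
    using mset_eq_permutation[OF assms(1)] by blast
  thus ?thesis using value_poly_permute_list assms(2) by blast
qed

lemma poly_value_poly_eq_0_iff:
  "poly (value_poly n c xs) v = 0 \<longleftrightarrow>
     (\<exists>\<sigma>. index_tuple n c \<sigma> \<and> v = (\<Sum>s\<in>supp_c n c. of_real (c s) * xs ! \<sigma> s))"
proof -
  have "(\<Sum>s\<in>supp_c n c. of_real (c s) * xs ! \<sigma> s) = (\<Sum>k<n. of_real (lin_form n c \<sigma> k) * xs ! k)"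
    if "index_tuple n c \<sigma>" for \<sigma>
  proof -
    obtain \<pi> where \<pi>: "\<pi> permutes {..<n}" "\<And>s. s \<in> supp_c n c \<Longrightarrow> \<sigma> s = \<pi> s"
      using index_tuple_eq_permutation[OF \<open>index_tuple n c \<sigma>\<close>] by blast
    have "(\<Sum>s\<in>supp_c n c. of_real (c s) * xs ! \<sigma> s) = (\<Sum>k<n. of_real (c k) * xs ! \<pi> k)"
      using \<pi>(2) by (intro sum.mono_neutral_cong_left) (auto simp: supp_c_def)
    thus ?thesis
      by (simp add: lin_form_permutation[OF \<pi>] sum_cutoff_comp_permutation[OF \<pi>(1)] del: comp_apply)
  qed
  moreover have "poly (value_poly n c xs) v = 0 \<longleftrightarrow>
      (\<exists>f\<in>forms n c. v = (\<Sum>k<n. of_real (f k) * xs ! k))"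
    unfolding value_poly_def poly_prod by (auto simp: prod_zero_iff)
  ultimately show ?thesis unfolding forms_def by auto
qed

lemma c_value_iff_root: "c_value n M c v \<longleftrightarrow> poly (p_poly n M c) v = 0"
  unfolding p_poly_eq_value_poly poly_value_poly_eq_0_iff c_value_def ..

lemma degree_p_poly: "degree (p_poly n M c) = deg_c n c"
  unfolding p_poly_def deg_c_def by (rule degree_prod_linear)

lemma lead_coeff_p_poly: "lead_coeff (p_poly n M c) = 1"
  unfolding p_poly_def by (simp add: lead_coeff_prod)

lemma p_poly_neq_0: "p_poly n M c \<noteq> 0"
  using lead_coeff_p_poly[of n M c] by auto

lemma poly_p_poly_smult:
  assumes M: "M \<in> carrier_mat n n" and s: "s \<noteq> 0"
  shows "poly (p_poly n (s \<cdot>\<^sub>m M) c) (s * t) = s ^ deg_c n c * poly (p_poly n M c) t"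
proof -
  have "p_poly n (s \<cdot>\<^sub>m M) c = value_poly n c (map ((*) s) (eig_list M))"
    unfolding p_poly_eq_value_poly
    by (rule value_poly_cong_mset)
      (simp_all add: mset_eig_list eig_mset_smult[OF M s] length_eig_list[OF M])
  also have "poly \<dots> (s * t) = (\<Prod>f\<in>forms n c. s * (t - (\<Sum>k<n. of_real (f k) * eig_list M ! k)))"
    unfolding value_poly_def poly_prod
    by (intro prod.cong) (auto simp: length_eig_list[OF M] algebra_simps sum_distrib_left)
  also have "\<dots> = s ^ deg_c n c * poly (p_poly n M c) t"
    by (simp add: prod.distrib deg_c_def p_poly_def poly_prod)
  finally show ?thesis .
qed

section \<open>The polynomial of the matrix pencil\<close>

abbreviation pencil :: "complex mat \<Rightarrow> complex \<Rightarrow> complex \<Rightarrow> complex mat" where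
  "pencil A x y \<equiv> x \<cdot>\<^sub>m A + y \<cdot>\<^sub>m mat_adjoint A"

lemma pencil_carrier:
  assumes "A \<in> carrier_mat n n"
  shows "pencil A x y \<in> carrier_mat n n"
  using assms mat_adjoint_carrier[OF assms] by auto

lemma pencil_scale:
  assumes "A \<in> carrier_mat n n"
  shows "pencil A (s * x) (s * y) = s \<cdot>\<^sub>m pencil A x y"
  by (intro eq_matI) (use assms mat_adjoint_carrier[OF assms] in \<open>auto simp: algebra_simps\<close>)

lemma pencil_1_0:
  assumes "A \<in> carrier_mat n n"
  shows "pencil A 1 0 = A"
  by (intro eq_matI) (use assms mat_adjoint_carrier[OF assms] in auto)

definition bivariate_polynomial_functions :: "('a :: field_char_0 \<times> 'a \<Rightarrow> 'a) set" where
  "bivariate_polynomial_functions = range (\<lambda>q p. eval2 (fst p) (snd p) q)"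

interpretation bivariate: function_algebra bivariate_polynomial_functions
proof
  fix a :: 'a and f g :: "'a \<times> 'a \<Rightarrow> 'a"
  show "(\<lambda>_. a) \<in> bivariate_polynomial_functions"
    unfolding bivariate_polynomial_functions_def
    by (rule range_eqI[of _ _ "[:[:a:]:]"]) (simp add: eval2_def)
  assume "f \<in> bivariate_polynomial_functions" "g \<in> bivariate_polynomial_functions"
  then obtain p q where "f = (\<lambda>z. eval2 (fst z) (snd z) p)" "g = (\<lambda>z. eval2 (fst z) (snd z) q)"
    unfolding bivariate_polynomial_functions_def by blast
  thus "(\<lambda>z. f z + g z) \<in> bivariate_polynomial_functions"
    "(\<lambda>z. f z * g z) \<in> bivariate_polynomial_functions"
    unfolding bivariate_polynomial_functions_def
    by (auto intro: range_eqI[of _ _ "p + q"] range_eqI[of _ _ "p * q"]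
        simp: eval2.hom_add eval2.hom_mult)
qed

lemma char_poly_eq_prod_eig_list:
  assumes "M \<in> carrier_mat n n"
  shows "char_poly M = (\<Prod>k<n. [:- eig_list M ! k, 1:])"
proof -
  have "char_poly M = (\<Prod>a\<leftarrow>eig_list M. [:- a, 1:])"
    unfolding char_poly_eq_prod_eig_mset[OF assms] mset_eig_list[symmetric]
    by (metis mset_map prod_mset_prod_list)
  thus ?thesis
    by (simp add: prod.list_conv_set_nth length_eig_list[OF assms] atLeast0LessThan)
qed

lemma coeff_char_poly_pencil_polynomial:
  assumes A: "A \<in> carrier_mat n n"
  shows "(\<lambda>z. coeff (char_poly (pencil A (fst z) (snd z))) l) \<in> bivariate_polynomial_functions"
proof -
  define M where "M = Matrix.mat n n (\<lambda>(i, j). [:[:0, A $$ (i, j):], [:mat_adjoint A $$ (i, j):]:])"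
  have M: "M \<in> carrier_mat n n" by (simp add: M_def)
  have "pencil A x y = map_mat (eval2 x y) M" for x y
    by (intro eq_matI)
      (use A mat_adjoint_carrier[OF A] in \<open>auto simp: M_def eval2_def algebra_simps\<close>)
  hence "coeff (char_poly (pencil A x y)) l = eval2 x y (coeff (char_poly M) l)" for x y
    by (simp add: eval2.char_poly_hom[OF M])
  thus ?thesis unfolding bivariate_polynomial_functions_def by auto
qed

lemma coeff_p_poly_pencil_polynomial:
  assumes A: "A \<in> carrier_mat n n"
  shows "(\<lambda>z. coeff (p_poly n (pencil A (fst z) (snd z)) c) l) \<in> bivariate_polynomial_functions"
proof -
  define \<alpha> where "\<alpha> k z = eig_list (pencil A (fst z) (snd z)) ! k" for k z
  have "char_poly (pencil A (fst z) (snd z)) = (\<Prod>k<n. [:- \<alpha> k z, 1:])" for z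
    unfolding \<alpha>_def by (rule char_poly_eq_prod_eig_list[OF pencil_carrier[OF A]])
  hence "coeff (\<Prod>k<n. [:1, - \<alpha> k z:]) q =
      (if q \<le> n then coeff (char_poly (pencil A (fst z) (snd z))) (n - q) else 0)" for z q
    by (simp add: coeff_prod_linear_reversed)
  hence "(\<lambda>z. coeff (\<Prod>k<n. [:1, - \<alpha> k z:]) q) \<in> bivariate_polynomial_functions" for q
    using coeff_char_poly_pencil_polynomial[OF A, of "n - q"] by (cases "q \<le> n") auto
  hence "(\<lambda>z. \<Sum>k<n. \<alpha> k z ^ q) \<in> bivariate_polynomial_functions" for q
    by (intro bivariate.power_sums_if_coeffs) auto
  hence "(\<lambda>z. coeff (\<Prod>f\<in>forms n c. [:- (\<Sum>k<n. of_real (f k) * \<alpha> k z), 1:]) l)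
      \<in> bivariate_polynomial_functions"
    by (rule coeff_prod_forms[OF bivariate.function_algebra_axioms])
  thus ?thesis unfolding p_poly_def \<alpha>_def .
qed

lemma map_poly_r_poly:
  assumes A: "A \<in> carrier_mat n n"
  shows "map_poly (eval2 x y) (r_poly n A c) = p_poly n (pencil A x y) c"
proof -
  have "\<exists>q. \<forall>x y. coeff (p_poly n (pencil A x y) c) l = eval2 x y q" for l
    using coeff_p_poly_pencil_polynomial[OF A, of c l] unfolding bivariate_polynomial_functions_def
    by (auto simp: fun_eq_iff)
  then obtain Q where Q: "\<And>l x y. coeff (p_poly n (pencil A x y) c) l = eval2 x y (Q l)" by metis
  define q where "q = (\<Sum>l\<le>deg_c n c. monom (Q l) l)"
  have q: "map_poly (eval2 x y) q = p_poly n (pencil A x y) c" for x y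
  proof (rule poly_eqI)
    fix i
    have "coeff q i = (if i \<le> deg_c n c then Q i else 0)"
      unfolding q_def by (auto simp: coeff_sum)
    thus "coeff (map_poly (eval2 x y) q) i = coeff (p_poly n (pencil A x y) c) i"
      by (auto simp: Q[symmetric] coeff_eq_0 degree_p_poly)
  qed
  have "r_poly n A c = q" unfolding r_poly_def
  proof (rule the_equality)
    show "\<forall>x y t. eval3 q x y t = poly (p_poly n (pencil A x y) c) t"
      by (simp add: eval3_eq_poly_map_poly q)
    fix p assume "\<forall>x y t. eval3 p x y t = poly (p_poly n (pencil A x y) c) t"
    hence "map_poly (eval2 x y) p = map_poly (eval2 x y) q" for x y
      by (simp add: eval3_eq_poly_map_poly q poly_eq_poly_eq_iff[symmetric] fun_eq_iff)
    thus "p = q" by (rule map_poly_eval2_inject)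
  qed
  thus ?thesis using q by simp
qed

lemma eval3_r_poly:
  assumes "A \<in> carrier_mat n n"
  shows "eval3 (r_poly n A c) x y t = poly (p_poly n (pencil A x y) c) t"
  unfolding eval3_eq_poly_map_poly map_poly_r_poly[OF assms] ..

lemma
  assumes A: "A \<in> carrier_mat n n"
  shows degree_r_poly: "degree (r_poly n A c) = deg_c n c"
    and lead_coeff_r_poly: "lead_coeff (r_poly n A c) = 1"
proof -
  let ?r = "r_poly n A c"
  have eval: "eval2 x y (coeff ?r i) = coeff (p_poly n (pencil A x y) c) i" for x y i
    unfolding map_poly_r_poly[OF A, symmetric] by simp
  have "eval2 x y (coeff ?r (deg_c n c) - 1) = 0" for x y
    using lead_coeff_p_poly[of n "pencil A x y" c] by (simp add: eval2.hom_minus eval degree_p_poly)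
  from eval2_eq_0_imp_eq_0[OF this] have lead: "coeff ?r (deg_c n c) = 1" by simp
  have "coeff ?r i = 0" if "i > deg_c n c" for i
    by (rule eval2_eq_0_imp_eq_0) (use that in \<open>simp add: eval coeff_eq_0 degree_p_poly\<close>)
  hence "degree ?r \<le> deg_c n c" by (intro degree_le) auto
  moreover have "deg_c n c \<le> degree ?r" using lead by (intro le_degree) simp
  ultimately show "degree ?r = deg_c n c" by simp
  thus "lead_coeff ?r = 1" using lead by simp
qed

lemma homogeneous3_r_poly:
  assumes "A \<in> carrier_mat n n"
  shows "homogeneous3 (deg_c n c) (r_poly n A c)"
  unfolding homogeneous3_def eval3_r_poly[OF assms] pencil_scale[OF assms]
  using poly_p_poly_smult[OF pencil_carrier[OF assms]] by blast

lemma c_value_iff_eval3_r_poly: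
  assumes "A \<in> carrier_mat n n"
  shows "c_value n A c v \<longleftrightarrow> eval3 (r_poly n A c) 1 0 v = 0"
  by (simp only: c_value_iff_root eval3_r_poly[OF assms] pencil_1_0[OF assms])

theorem common_c_values_if_resultant_r_poly_eq_0:
  assumes A: "A \<in> carrier_mat n n" and B: "B \<in> carrier_mat m m"
    and resultant_0: "resultant (r_poly n A c) (r_poly m B d) = 0"
  shows "\<exists>v. c_value n A c v \<and> c_value m B d v"
    and "irreducible (r_poly n A c) \<Longrightarrow> c_value n A c v \<Longrightarrow> c_value m B d v"
proof -
  have "resultant (p_poly n A c) (p_poly m B d) = 0"
    using resultant_0
      eval2.resultant_map_poly_monic[OF lead_coeff_r_poly[OF A] lead_coeff_r_poly[OF B], of 1 0 c d]
    by (simp add: map_poly_r_poly[OF A] map_poly_r_poly[OF B] pencil_1_0[OF A] pencil_1_0[OF B])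
  thus "\<exists>v. c_value n A c v \<and> c_value m B d v"
    unfolding c_value_iff_root resultant_eq_0_iff_common_root[OF p_poly_neq_0] .
next
  assume "irreducible (r_poly n A c)" and v: "c_value n A c v"
  hence "r_poly n A c dvd r_poly m B d" using irreducible_dvd_if_resultant_eq_0 resultant_0 by blast
  then obtain h where "r_poly m B d = r_poly n A c * h" by (elim dvdE)
  thus "c_value m B d v"
    using v by (simp add: c_value_iff_eval3_r_poly[OF A] c_value_iff_eval3_r_poly[OF B] eval3_def)
qed

section \<open>Supporting lines of the weighted numerical range\<close>

lemma H_theta_eq_pencil:
  assumes A: "A \<in> carrier_mat n n"
  shows "H_theta \<theta> A = pencil A (cis \<theta> / 2) (cis (- \<theta>) / 2)"
  unfolding H_theta_def
  by (intro eq_matI) (use A mat_adjoint_carrier[OF A] in \<open>auto simp: cis_conv_exp algebra_simps\<close>)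

lemma H_theta_carrier:
  assumes "A \<in> carrier_mat n n"
  shows "H_theta \<theta> A \<in> carrier_mat n n"
  unfolding H_theta_eq_pencil[OF assms] by (rule pencil_carrier[OF assms])

lemma H_theta_Hermitian:
  assumes A: "A \<in> carrier_mat n n"
  shows "mat_adjoint (H_theta \<theta> A) = H_theta \<theta> A"
proof (rule eq_matI)
  note H = H_theta_carrier[OF A, of \<theta>]
  fix i j assume "i < dim_row (H_theta \<theta> A)" "j < dim_col (H_theta \<theta> A)"
  hence ij: "i < n" "j < n" using H by auto
  have entry: "H_theta \<theta> A $$ (i, j) = cis \<theta> / 2 * A $$ (i, j) + cis (- \<theta>) / 2 * cnj (A $$ (j, i))"
    if "i < n" "j < n" for i j
    unfolding H_theta_eq_pencil[OF A] using that A mat_adjoint_carrier[OF A]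
    by (simp add: mat_adjoint_index[OF A])
  show "mat_adjoint (H_theta \<theta> A) $$ (i, j) = H_theta \<theta> A $$ (i, j)"
    using ij by (simp add: mat_adjoint_index[OF H ij] entry cis_cnj add.commute)
qed (use H_theta_carrier[OF A, of \<theta>] mat_adjoint_carrier[OF H_theta_carrier[OF A, of \<theta>]] in auto)

lemma quadratic_form_H_theta:
  assumes A: "A \<in> carrier_mat n n" and x: "x \<in> carrier_vec n"
  shows "conjugate x \<bullet> (H_theta \<theta> A *\<^sub>v x) = of_real (Re (cis \<theta> * (conjugate x \<bullet> (A *\<^sub>v x))))"
proof -
  let ?q = "conjugate x \<bullet> (A *\<^sub>v x)"
  note A_adjoint = mat_adjoint_carrier[OF A]
  have "cnj ?q = x \<bullet>c (A *\<^sub>v x)"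
    using conjugate_conjugate_sprod[of x n "A *\<^sub>v x"] A x by simp
  also have "\<dots> = conjugate (A *\<^sub>v x) \<bullet> x"
    using A x by (intro conjugate_vec_sprod_comm) auto
  also have "\<dots> = conjugate x \<bullet> (mat_adjoint A *\<^sub>v x)"
    by (rule conjugate_mult_mat_vec_scalar_prod[OF A x x])
  finally have adjoint_form: "conjugate x \<bullet> (mat_adjoint A *\<^sub>v x) = cnj ?q" ..
  have smult: "(k \<cdot>\<^sub>m M) *\<^sub>v x = k \<cdot>\<^sub>v (M *\<^sub>v x)" if "M \<in> carrier_mat n n" for k :: complex and M
    by (rule eq_vecI) (use that x in \<open>auto simp: scalar_prod_def sum_distrib_left mult.assoc\<close>)
  have "H_theta \<theta> A *\<^sub>v x = (cis \<theta> / 2) \<cdot>\<^sub>v (A *\<^sub>v x) + (cis (- \<theta>) / 2) \<cdot>\<^sub>v (mat_adjoint A *\<^sub>v x)"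
    unfolding H_theta_eq_pencil[OF A] using A A_adjoint x
    by (simp add: add_mult_distrib_mat_vec[of _ n n] smult)
  hence "conjugate x \<bullet> (H_theta \<theta> A *\<^sub>v x) = cis \<theta> / 2 * ?q + cis (- \<theta>) / 2 * cnj ?q"
    using A A_adjoint x
    by (simp add: scalar_prod_add_distrib[of _ n] scalar_prod_smult_distrib[of _ n] adjoint_form)
  also have "\<dots> = (cis \<theta> * ?q + cnj (cis \<theta> * ?q)) / 2"
    by (simp add: cis_cnj add_divide_distrib)
  also have "\<dots> = of_real (Re (cis \<theta> * ?q))" by (subst complex_add_cnj) simp
  finally show ?thesis .
qed

definition support_bound :: "nat \<Rightarrow> complex mat \<Rightarrow> (nat \<Rightarrow> real) \<Rightarrow> real \<Rightarrow> real" where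
  "support_bound n A c \<theta> = (\<Sum>j<n. c j * herm_eig (H_theta \<theta> A) ! j)"

lemma W_weighted_eq: "W_weighted n A c = halfplane_intersection {0..<2*pi} (support_bound n A c)"
  unfolding W_weighted_def halfplane_intersection_def support_bound_def cis_conv_exp ..

lemma support_bound_root:
  assumes A: "A \<in> carrier_mat n n"
  shows "poly (p_poly n (H_theta \<theta> A) c) (of_real (support_bound n A c \<theta>)) = 0"
proof -
  note H = H_theta_carrier[OF A, of \<theta>]
  let ?es = "map complex_of_real (herm_eig (H_theta \<theta> A))"
  note len = length_herm_eig[OF H]
  have "support_bound n A c \<theta> = (\<Sum>s\<in>supp_c n c. c s * herm_eig (H_theta \<theta> A) ! s)"
    unfolding support_bound_def supp_c_def by (rule sum.mono_neutral_right) auto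
  hence "of_real (support_bound n A c \<theta>) = (\<Sum>s\<in>supp_c n c. of_real (c s) * ?es ! id s)"
    using len by (auto simp: supp_c_def intro!: sum.cong)
  hence "poly (value_poly n c ?es) (of_real (support_bound n A c \<theta>)) = 0"
    unfolding poly_value_poly_eq_0_iff using permutes_imp_index_tuple[OF permutes_id] by blast
  moreover have "p_poly n (H_theta \<theta> A) c = value_poly n c ?es"
    unfolding p_poly_eq_value_poly using mset_herm_eig[OF H H_theta_Hermitian[OF A]] len
    by (intro value_poly_cong_mset) (simp_all add: mset_eig_list)
  ultimately show ?thesis by simp
qed

lemma ex_W_c_attaining_support_bound:
  assumes A: "A \<in> carrier_mat n n"
  obtains z where "z \<in> W_c n A c" "Re (cis \<theta> * z) = support_bound n A c \<theta>"
proof -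
  obtain x where x: "orthonormal_family n x"
    "\<And>j. j < n \<Longrightarrow> conjugate (x j) \<bullet> (H_theta \<theta> A *\<^sub>v x j) = of_real (herm_eig (H_theta \<theta> A) ! j)"
    using ex_orthonormal_family_herm_eig[OF H_theta_carrier[OF A] H_theta_Hermitian[OF A]] by blast
  define z where "z = (\<Sum>j<n. of_real (c j) * (conjugate (x j) \<bullet> (A *\<^sub>v x j)))"
  have "z \<in> W_c n A c"
    using x(1) unfolding W_c_def z_def orthonormal_family_def by blast
  moreover have "Re (cis \<theta> * (conjugate (x j) \<bullet> (A *\<^sub>v x j))) = herm_eig (H_theta \<theta> A) ! j"
    if "j < n" for j
    using quadratic_form_H_theta[OF A orthonormal_familyD(1)[OF x(1) that]] x(2)[OF that]
    by (metis of_real_eq_iff)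
  hence "Re (cis \<theta> * z) = support_bound n A c \<theta>"
    by (simp add: z_def support_bound_def sum_distrib_left mult.left_commute[of "cis \<theta>"])
  ultimately show ?thesis using that by blast
qed

lemma tendsto_eval2:
  fixes X Y :: "'i \<Rightarrow> complex"
  assumes "(X \<longlongrightarrow> x) F" "(Y \<longlongrightarrow> y) F"
  shows "((\<lambda>k. eval2 (X k) (Y k) q) \<longlongrightarrow> eval2 x y q) F"
proof (induction q)
  case (pCons a q)
  have "eval2 x y (pCons a q) = poly a x + y * eval2 x y q" for x y by (simp add: eval2_def)
  thus ?case by (simp only:) (intro tendsto_intros pCons.IH assms tendsto_poly)
qed simp

lemma tendsto_p_poly_pencil:
  assumes A: "A \<in> carrier_mat n n" and "(X \<longlongrightarrow> x) F" "(Y \<longlongrightarrow> y) F" "(T \<longlongrightarrow> t) F"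
  shows "((\<lambda>k. poly (p_poly n (pencil A (X k) (Y k)) c) (T k)) \<longlongrightarrow>
    poly (p_poly n (pencil A x y) c) t) F"
proof -
  have "poly (p_poly n (pencil A x y) c) t =
      (\<Sum>l\<le>deg_c n c. eval2 x y (coeff (r_poly n A c) l) * t ^ l)" for x y t
    unfolding poly_altdef degree_p_poly by (simp flip: map_poly_r_poly[OF A])
  thus ?thesis by (simp only:) (intro tendsto_intros tendsto_eval2 assms)
qed

text \<open>The support bound is a root of the pencil polynomial in every direction, and this survives
  limits of directions.\<close>
lemma frontier_W_weighted_supporting:
  assumes A: "A \<in> carrier_mat n n" and z: "z \<in> frontier (W_weighted n A c)"
  obtains \<theta> where "\<And>v. v \<in> W_weighted n A c \<Longrightarrow> Re (cis \<theta> * v) \<le> Re (cis \<theta> * z)"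
    "poly (p_poly n (H_theta \<theta> A) c) (of_real (Re (cis \<theta> * z))) = 0"
proof -
  let ?h = "support_bound n A c"
  have "bounded {0..<2*pi}" by (rule bounded_subset[OF bounded_closed_interval[of 0 "2*pi"]]) auto
  then obtain \<phi> \<theta> where \<phi>: "\<And>k. \<phi> k \<in> {0..<2*pi}" "\<phi> \<longlonglongrightarrow> \<theta>"
    and h: "(\<lambda>k. ?h (\<phi> k)) \<longlonglongrightarrow> Re (cis \<theta> * z)"
    using frontier_halfplane_intersection_limit_direction z unfolding W_weighted_eq by blast
  have "(\<lambda>k. poly (p_poly n (H_theta (\<phi> k) A) c) (of_real (?h (\<phi> k)))) \<longlonglongrightarrow>
      poly (p_poly n (H_theta \<theta> A) c) (of_real (Re (cis \<theta> * z)))"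
    unfolding H_theta_eq_pencil[OF A]
    by (intro tendsto_p_poly_pencil[OF A] tendsto_intros \<phi>(2) h) simp_all
  hence "poly (p_poly n (H_theta \<theta> A) c) (of_real (Re (cis \<theta> * z))) = 0"
    by (simp add: support_bound_root[OF A] LIMSEQ_const_iff)
  moreover have "Re (cis \<theta> * v) \<le> Re (cis \<theta> * z)" if "v \<in> W_weighted n A c" for v
    using that \<phi> h unfolding W_weighted_eq by (rule halfplane_intersection_limit_le)
  ultimately show ?thesis using that by blast
qed

definition regular_contact :: "nat \<Rightarrow> complex mat \<Rightarrow> (nat \<Rightarrow> real) \<Rightarrow> complex set \<Rightarrow> bool" where
  "regular_contact n A c L \<longleftrightarrow> W_weighted n A c = W_c n A c \<or>
     interior (W_weighted n A c) \<noteq> {} \<and> (\<exists>z\<in>L. boundary_differentiable_at (W_weighted n A c) z)"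

lemma supporting_line_offset_root:
  assumes A: "A \<in> carrier_mat n n" and \<theta>: "\<theta> \<in> {0..<2*pi}"
    and supp: "W_weighted n A c \<subseteq> {v. Re (cis \<theta> * v) \<le> a}"
    and meets: "W_weighted n A c \<inter> {v. Re (cis \<theta> * v) = a} \<noteq> {}"
    and contact: "regular_contact n A c {v. Re (cis \<theta> * v) = a}"
  shows "poly (p_poly n (H_theta \<theta> A) c) (of_real a) = 0"
  using contact unfolding regular_contact_def
proof (elim disjE conjE bexE)
  assume W_eq: "W_weighted n A c = W_c n A c"
  obtain z where z: "z \<in> W_c n A c" "Re (cis \<theta> * z) = support_bound n A c \<theta>"
    using ex_W_c_attaining_support_bound[OF A] by blast
  have "support_bound n A c \<theta> \<le> a" using supp z W_eq by auto
  moreover have "a \<le> support_bound n A c \<theta>"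
    using meets \<theta> unfolding W_weighted_eq halfplane_intersection_def by auto
  ultimately show ?thesis using support_bound_root[OF A, of \<theta> c] by simp
next
  let ?W = "W_weighted n A c"
  fix z assume interior_nonempty: "interior ?W \<noteq> {}" and "z \<in> {v. Re (cis \<theta> * v) = a}"
    and differentiable: "boundary_differentiable_at ?W z"
  hence z: "Re (cis \<theta> * z) = a" by simp
  have closed: "closed ?W" unfolding W_weighted_eq by (rule closed_halfplane_intersection)
  have "z \<in> frontier ?W" using differentiable by (simp add: boundary_differentiable_at_def)
  then obtain \<phi> where \<phi>: "\<And>v. v \<in> ?W \<Longrightarrow> Re (cis \<phi> * v) \<le> Re (cis \<phi> * z)"
    "poly (p_poly n (H_theta \<phi> A) c) (of_real (Re (cis \<phi> * z))) = 0"
    using frontier_W_weighted_supporting[OF A] by blast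
  have same_direction: "cis \<phi> = cis \<theta>"
    by (rule supporting_functional_unique[OF closed interior_nonempty differentiable _ \<phi>(1)])
      (use supp z in auto)
  hence "cis (- \<phi>) = cis (- \<theta>)" by (simp flip: cis_cnj)
  hence "H_theta \<phi> A = H_theta \<theta> A" unfolding H_theta_eq_pencil[OF A] using same_direction by simp
  thus ?thesis using \<phi>(2) unfolding same_direction z by simp
qed

section \<open>Common supporting lines as common zeros\<close>

text \<open>The line whose dual projective point is \<open>(x : 1 : t)\<close>.\<close>
definition dual_line :: "complex \<Rightarrow> complex \<Rightarrow> complex set" where
  "dual_line x t = {z. x * z + cnj z = t}"

lemma line_eq_dual_line: "{z. Re (cis \<theta> * z) = a} = dual_line (cis (2 * \<theta>)) (2 * cis \<theta> * of_real a)"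
proof -
  have "Re (cis \<theta> * z) = a \<longleftrightarrow> cis (2 * \<theta>) * z + cnj z = 2 * cis \<theta> * of_real a" for z
  proof -
    have "cis (2 * \<theta>) * z + cnj z = cis \<theta> * (cis \<theta> * z + cnj (cis \<theta> * z))"
      by (simp add: distrib_left cis_cnj cis_mult mult.assoc[symmetric])
    also have "\<dots> = 2 * cis \<theta> * of_real (Re (cis \<theta> * z))"
      by (subst complex_add_cnj) simp
    finally have "cis (2 * \<theta>) * z + cnj z = 2 * cis \<theta> * of_real (Re (cis \<theta> * z))" .
    thus ?thesis by (simp del: times_complex.sel)
  qed
  thus ?thesis by (simp add: dual_line_def)
qed

lemma common_supporting_line_cis:
  assumes "common_supporting_line K1 K2 L"
  obtains \<theta> a where "\<theta> \<in> {0..<2*pi}" "L = {z. Re (cis \<theta> * z) = a}"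
    "K1 \<subseteq> {z. Re (cis \<theta> * z) \<le> a}" "K2 \<subseteq> {z. Re (cis \<theta> * z) \<le> a}"
proof -
  obtain u a where u: "u \<noteq> 0" "L = {z. Re (cnj u * z) = a}"
    and sub: "K1 \<subseteq> {z. Re (cnj u * z) \<le> a}" "K2 \<subseteq> {z. Re (cnj u * z) \<le> a}"
    using assms unfolding common_supporting_line_def by blast
  define \<theta> r where "\<theta> = Arg2pi (cnj u)" and "r = cmod u"
  have r: "r > 0" using u(1) by (simp add: r_def)
  have "cnj u = of_real r * cis \<theta>"
    using Arg2pi_eq[of "cnj u"] by (simp add: \<theta>_def r_def cis_conv_exp)
  hence Re_eq: "Re (cnj u * z) = r * Re (cis \<theta> * z)" for z by (simp add: algebra_simps)
  show ?thesis
  proof (rule that)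
    show "\<theta> \<in> {0..<2*pi}" using Arg2pi_ge_0 Arg2pi_lt_2pi by (simp add: \<theta>_def)
    show "L = {z. Re (cis \<theta> * z) = a / r}"
      unfolding u(2) Re_eq using r
      by (auto simp: eq_divide_eq mult.commute simp del: times_complex.sel)
    show "K1 \<subseteq> {z. Re (cis \<theta> * z) \<le> a / r}" "K2 \<subseteq> {z. Re (cis \<theta> * z) \<le> a / r}"
      using sub r unfolding Re_eq
      by (auto simp: pos_le_divide_eq mult.commute simp del: times_complex.sel)
  qed
qed

lemma eval3_r_poly_supporting_line_eq_0:
  assumes A: "A \<in> carrier_mat n n" and "\<theta> \<in> {0..<2*pi}"
    and "W_weighted n A c \<subseteq> {v. Re (cis \<theta> * v) \<le> a}"
    and "W_weighted n A c \<inter> {v. Re (cis \<theta> * v) = a} \<noteq> {}"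
    and "regular_contact n A c {v. Re (cis \<theta> * v) = a}"
  shows "eval3 (r_poly n A c) (cis (2 * \<theta>)) 1 (2 * cis \<theta> * of_real a) = 0"
proof -
  have "eval3 (r_poly n A c) (cis \<theta> / 2) (cis (- \<theta>) / 2) (of_real a) = 0"
    using supporting_line_offset_root[OF assms]
    unfolding eval3_r_poly[OF A] H_theta_eq_pencil[OF A] .
  moreover have "2 * cis \<theta> * (cis \<theta> / 2) = cis (2 * \<theta>)" "2 * cis \<theta> * (cis (- \<theta>) / 2) = 1"
    by (simp_all add: cis_mult)
  ultimately show ?thesis
    using homogeneous3_scale_eq_0_iff[OF homogeneous3_r_poly[OF A],
        of "2 * cis \<theta>" c "cis \<theta> / 2" "cis (- \<theta>) / 2" "of_real a"]
    by simp
qed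

lemma common_supporting_line_common_zero:
  assumes A: "A \<in> carrier_mat n n" and B: "B \<in> carrier_mat m m"
    and L: "common_supporting_line (W_weighted n A c) (W_weighted m B d) L"
    and "regular_contact n A c L" "regular_contact m B d L"
  obtains x t where "L = dual_line x t"
    "eval3 (r_poly n A c) x 1 t = 0" "eval3 (r_poly m B d) x 1 t = 0"
proof -
  obtain \<theta> a where \<theta>: "\<theta> \<in> {0..<2*pi}" and L_eq: "L = {z. Re (cis \<theta> * z) = a}"
    and sub: "W_weighted n A c \<subseteq> {z. Re (cis \<theta> * z) \<le> a}"
      "W_weighted m B d \<subseteq> {z. Re (cis \<theta> * z) \<le> a}"
    using common_supporting_line_cis[OF L] by blast
  have meets: "W_weighted n A c \<inter> L \<noteq> {}" "W_weighted m B d \<inter> L \<noteq> {}"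
    using L unfolding common_supporting_line_def by blast+
  show ?thesis
    using that line_eq_dual_line[of \<theta> a]
      eval3_r_poly_supporting_line_eq_0[OF A \<theta> sub(1)]
      eval3_r_poly_supporting_line_eq_0[OF B \<theta> sub(2)]
      meets assms(4,5) unfolding L_eq by blast
qed

theorem resultant_r_poly_eq_0:
  assumes A: "A \<in> carrier_mat n n" and B: "B \<in> carrier_mat m m"
    and Ls: "finite Ls" "card Ls > deg_c n c * deg_c m d"
    and lines: "\<And>L. L \<in> Ls \<Longrightarrow> common_supporting_line (W_weighted n A c) (W_weighted m B d) L"
      "\<And>L. L \<in> Ls \<Longrightarrow> regular_contact n A c L" "\<And>L. L \<in> Ls \<Longrightarrow> regular_contact m B d L"
  shows "resultant (r_poly n A c) (r_poly m B d) = 0"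
proof -
  have "\<exists>x t. L = dual_line x t \<and> eval3 (r_poly n A c) x 1 t = 0 \<and> eval3 (r_poly m B d) x 1 t = 0"
    if "L \<in> Ls" for L
    using common_supporting_line_common_zero[OF A B lines(1-3)[OF that]] by metis
  then obtain x t where dual: "\<And>L. L \<in> Ls \<Longrightarrow> L = dual_line (x L) (t L)"
    and zero: "\<And>L. L \<in> Ls \<Longrightarrow> eval3 (r_poly n A c) (x L) 1 (t L) = 0"
      "\<And>L. L \<in> Ls \<Longrightarrow> eval3 (r_poly m B d) (x L) 1 (t L) = 0"
    by metis
  let ?P = "(\<lambda>L. (x L, t L)) ` Ls"
  have "inj_on (\<lambda>L. (x L, t L)) Ls" by (rule inj_onI) (metis dual prod.inject)
  hence "card ?P = card Ls" by (rule card_image)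
  thus ?thesis
    using Ls zero homogeneous3_r_poly[OF A] homogeneous3_r_poly[OF B]
    by (intro bezout_homogeneous[where P = ?P,
          OF _ lead_coeff_r_poly[OF A] _ lead_coeff_r_poly[OF B]])
      (auto simp: degree_r_poly[OF A] degree_r_poly[OF B])
qed

theorem mainTheorem10:
  fixes A B :: "complex mat" and n m :: nat and c d :: "nat \<Rightarrow> real"
  assumes "A \<in> carrier_mat n n" and "B \<in> carrier_mat m m"
    and "W_weighted n A c \<noteq> {}" and "W_weighted m B d \<noteq> {}"
    and "\<exists>Ls. finite Ls \<and> card Ls > deg_c n c * deg_c m d \<and>
           (\<forall>L\<in>Ls. common_supporting_line (W_weighted n A c) (W_weighted m B d) L) \<and>
           (W_weighted n A c = W_c n A c \<or>
              (interior (W_weighted n A c) \<noteq> {} \<and>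
               (\<forall>L\<in>Ls. \<exists>z\<in>L. boundary_differentiable_at (W_weighted n A c) z))) \<and>
           (W_weighted m B d = W_c m B d \<or>
              (interior (W_weighted m B d) \<noteq> {} \<and>
               (\<forall>L\<in>Ls. \<exists>z\<in>L. boundary_differentiable_at (W_weighted m B d) z)))"
  shows "(\<exists>v. c_value n A c v \<and> c_value m B d v) \<and>
         (irreducible (r_poly n A c) \<longrightarrow> (\<forall>v. c_value n A c v \<longrightarrow> c_value m B d v))"
proof -
  obtain Ls where "finite Ls" "card Ls > deg_c n c * deg_c m d"
    and "\<forall>L\<in>Ls. common_supporting_line (W_weighted n A c) (W_weighted m B d) L"
    and "\<forall>L\<in>Ls. regular_contact n A c L" "\<forall>L\<in>Ls. regular_contact m B d L"
    using assms(5) unfolding regular_contact_def by metis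
  hence "resultant (r_poly n A c) (r_poly m B d) = 0"
    by (intro resultant_r_poly_eq_0[OF assms(1,2)]) auto
  thus ?thesis
    using common_c_values_if_resultant_r_poly_eq_0[OF assms(1,2)] by blast
qed

end
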